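(* Let $\mathsf{M}$ be a $t$-motive over $K$. Then the $k$-th prolongation $\rho_k\mathsf{M}$ is a $t$-motive for all $k\geq 0$. If $\mathsf{M}$ is abelian, then so is $\rho_k\mathsf{M}$.
   Context: Let $K$ be a finite extension of $\mathbb{F}_q(\theta)$. For $a=\sum x_it^i\in K[t]$ put $a^\tau=\sum x_i^qt^i$. $K[t]\{\tau\}$ is the skew polynomial ring over $K[t]$ with $\tau a=a^\tau\tau$, and $K\{\tau\}\subset K[t]\{\tau\}$ is the corresponding skew polynomial ring over $K$. A $t$-motive $\mathsf{M}$ is a left $K[t]\{\tau\}$-module which is free and finitely generated as a $K\{\tau\}$-module and such that $(t-\theta)^\ell \mathsf{M}\subseteq K[t]\cdot\tau(\mathsf{M})$ for some $\ell\in\mathbb{N}$. It is called abelian if it is also finitely generated as a $K[t]$-module (in which case it is even free over $K[t]$). Hyperdifferential operators on $K[t]$: the $K$-linear maps with $\partial_t^{(n)}(t^i)=\binom{i}{n}t^{i-n}$. Prolongation: for a left $K[t]\{\tau\}$-module $\mathsf{M}$ and $k\ge0$, the $k$-th prolongation $\rho_k\mathsf{M}$ is the $K[t]$-module generated by symbols $D_im$ ($i=0,\dots,k$, $m\in\mathsf{M}$) subject to the relations $D_i(m_1+m_2)=D_im_1+D_im_2$ and $D_i(a m)=\sum_{i_1+i_2=i}\partial_t^{(i_1)}(a)\cdot D_{i_2}m$ for all $m,m_1,m_2\in\mathsf{M}$, $a\in K[t]$, $0\le i\le k$. It is a $K[t]\{\tau\}$-module via the semilinear action $\tau(a\cdot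 D_im)=a^\tau\cdot D_i(\tau(m))$. *)

theory Defs
  imports
    "HOL-Algebra.Algebraic_Closure_Type"
    "HOL-Algebra.Generated_Fields"
    "HOL-Algebra.Finite_Extensions"
    "HOL-Algebra.Module"
    "HOL-Library.Poly_Mapping"
begin

section \<open>Modules over a ring that need not be commutative\<close>

text \<open>The locale \<open>module\<close> of HOL-Algebra requires a commutative ring of scalars. The record type
  \<open>module\<close> extends \<open>ring\<close>; as in HOL-Algebra, its multiplicative fields \<open>mult\<close> and \<open>one\<close>
  play no role for modules.\<close>

locale left_module = R?: ring R + M?: abelian_group M
  for R :: "('r, 'x) ring_scheme" (structure) and M :: "('r, 'm, 'y) module_scheme" (structure) +
  assumes smult_closed:
      "\<lbrakk>a \<in> carrier R; x \<in> carrier M\<rbrakk> \<Longrightarrow> a \<odot>\<^bsub>M\<^esub> x \<in> carrier M"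
    and smult_l_distr:
      "\<lbrakk>a \<in> carrier R; b \<in> carrier R; x \<in> carrier M\<rbrakk> \<Longrightarrow>
        (a \<oplus> b) \<odot>\<^bsub>M\<^esub> x = a \<odot>\<^bsub>M\<^esub> x \<oplus>\<^bsub>M\<^esub> b \<odot>\<^bsub>M\<^esub> x"
    and smult_r_distr:
      "\<lbrakk>a \<in> carrier R; x \<in> carrier M; y \<in> carrier M\<rbrakk> \<Longrightarrow>
        a \<odot>\<^bsub>M\<^esub> (x \<oplus>\<^bsub>M\<^esub> y) = a \<odot>\<^bsub>M\<^esub> x \<oplus>\<^bsub>M\<^esub> a \<odot>\<^bsub>M\<^esub> y"
    and smult_assoc:
      "\<lbrakk>a \<in> carrier R; b \<in> carrier R; x \<in> carrier M\<rbrakk> \<Longrightarrow>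
        (a \<otimes> b) \<odot>\<^bsub>M\<^esub> x = a \<odot>\<^bsub>M\<^esub> (b \<odot>\<^bsub>M\<^esub> x)"
    and smult_one:
      "x \<in> carrier M \<Longrightarrow> \<one> \<odot>\<^bsub>M\<^esub> x = x"

definition left_span ::
    "('r, 'x) ring_scheme \<Rightarrow> ('r, 'm, 'y) module_scheme \<Rightarrow> 'm set \<Rightarrow> 'm set" where
  "left_span R M S =
     {finsum M (\<lambda>s. c s \<odot>\<^bsub>M\<^esub> s) A | c A. finite A \<and> A \<subseteq> S \<and> c \<in> A \<rightarrow> carrier R}"

definition left_independent ::
    "('r, 'x) ring_scheme \<Rightarrow> ('r, 'm, 'y) module_scheme \<Rightarrow> 'm set \<Rightarrow> bool" where
  "left_independent R M B \<longleftrightarrow>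
     (\<forall>A c. finite A \<longrightarrow> A \<subseteq> B \<longrightarrow> c \<in> A \<rightarrow> carrier R \<longrightarrow>
        finsum M (\<lambda>b. c b \<odot>\<^bsub>M\<^esub> b) A = \<zero>\<^bsub>M\<^esub> \<longrightarrow> (\<forall>b\<in>A. c b = \<zero>\<^bsub>R\<^esub>))"

definition free_left_module ::
    "('r, 'x) ring_scheme \<Rightarrow> ('r, 'm, 'y) module_scheme \<Rightarrow> bool" where
  "free_left_module R M \<longleftrightarrow>
     (\<exists>B \<subseteq> carrier M. left_independent R M B \<and> left_span R M B = carrier M)"

definition fin_gen_left_module ::
    "('r, 'x) ring_scheme \<Rightarrow> ('r, 'm, 'y) module_scheme \<Rightarrow> bool" where
  "fin_gen_left_module R M \<longleftrightarrow>
     (\<exists>S \<subseteq> carrier M. finite S \<and> left_span R M S = carrier M)"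

definition free_module_on :: "'s set \<Rightarrow> ('r::comm_ring_1, 's \<Rightarrow>\<^sub>0 'r) module" where
  "free_module_on S =
     \<lparr>carrier = {f. Poly_Mapping.keys f \<subseteq> S}, monoid.mult = undefined, one = undefined,
      ring.zero = 0, add = (+), module.smult = (\<lambda>a f. Poly_Mapping.map (\<lambda>b. a * b) f)\<rparr>"

definition quotient_module ::
    "('r, 'm, 'y) module_scheme \<Rightarrow> 'm set \<Rightarrow> ('r, 'm set) module" where
  "quotient_module M N =
     \<lparr>carrier = a_rcosets\<^bsub>M\<^esub> N, monoid.mult = undefined, one = undefined,
      ring.zero = N, add = set_add M, module.smult = (\<lambda>a C. \<Union>x\<in>C. N +>\<^bsub>M\<^esub> (a \<odot>\<^bsub>M\<^esub> x))\<rparr>"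


section \<open>The skew polynomial ring \<open>K[t]{\<tau>}\<close>\<close>

definition twist :: "nat \<Rightarrow> 'k::field poly \<Rightarrow> 'k poly" where
  "twist q a = map_poly (\<lambda>x. x ^ q) a"

text \<open>The element \<open>\<Sum>i. a\<^sub>i \<tau>\<^sup>i\<close> of \<open>K[t]{\<tau>}\<close> is represented by the polynomial with coefficients
  \<open>a\<^sub>i \<in> K[t]\<close>, so \<open>\<tau>\<close> is \<open>monom 1 1\<close> and \<open>a \<in> K[t]\<close> is the constant \<open>[:a:]\<close>. Addition is
  that of the type \<open>'k poly poly\<close>; multiplication, determined by \<open>\<tau> a = a\<^sup>\<tau> \<tau>\<close>, is not.\<close>

definition skew_poly_ring :: "nat \<Rightarrow> 'k::field poly poly ring" where
  "skew_poly_ring q =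
     \<lparr>carrier = UNIV,
      monoid.mult = (\<lambda>P Q. \<Sum>i\<le>Polynomial.degree P. \<Sum>j\<le>Polynomial.degree Q.
        Polynomial.monom
          (Polynomial.coeff P i * (twist q ^^ i) (Polynomial.coeff Q j)) (i + j)),
      one = 1, ring.zero = 0, add = (+)\<rparr>"

abbreviation skew_tau :: "'k::field poly poly" where
  "skew_tau \<equiv> Polynomial.monom 1 1"

definition poly_subring :: "nat \<Rightarrow> 'k::field poly poly ring" where
  "poly_subring q = (skew_poly_ring q)\<lparr>carrier := {[:a:] | a. True}\<rparr>"

definition const_skew_subring :: "nat \<Rightarrow> 'k::field poly poly ring" where
  "const_skew_subring q =
     (skew_poly_ring q)\<lparr>carrier := {P. \<forall>i. \<exists>x. Polynomial.coeff P i = [:x:]}\<rparr>"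

lemma skew_tau_commute:
  assumes "0 < q"
  shows "skew_tau \<otimes>\<^bsub>skew_poly_ring q\<^esub> [:a:] = [:twist q a:] \<otimes>\<^bsub>skew_poly_ring q\<^esub> skew_tau"
  using assms
  by (simp add: skew_poly_ring_def Polynomial.degree_monom_eq twist_def)


section \<open>\<open>t\<close>-motives\<close>

text \<open>The scalar \<open>t - \<theta>\<close> is \<open>[:- \<theta>, 1:]\<close>.\<close>

definition t_motive ::
    "nat \<Rightarrow> 'k::field \<Rightarrow> ('k poly poly, 'm) module \<Rightarrow> bool" where
  "t_motive q \<theta> M \<longleftrightarrow>
     left_module (skew_poly_ring q) M \<and>
     free_left_module (const_skew_subring q) M \<and>
     fin_gen_left_module (const_skew_subring q) M \<and>
     (\<exists>l::nat. \<forall>m\<in>carrier M. [:[:- \<theta>, 1:] ^ l:] \<odot>\<^bsub>M\<^esub> m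
        \<in> left_span (poly_subring q) M ((\<lambda>m'. skew_tau \<odot>\<^bsub>M\<^esub> m') ` carrier M))"

definition abelian_t_motive ::
    "nat \<Rightarrow> 'k::field \<Rightarrow> ('k poly poly, 'm) module \<Rightarrow> bool" where
  "abelian_t_motive q \<theta> M \<longleftrightarrow> t_motive q \<theta> M \<and> fin_gen_left_module (poly_subring q) M"


section \<open>Prolongations\<close>

definition hyperderiv :: "nat \<Rightarrow> 'k::field poly \<Rightarrow> 'k poly" where
  "hyperderiv n a =
     (\<Sum>i\<le>Polynomial.degree a.
        Polynomial.monom (of_nat (i choose n) * Polynomial.coeff a i) (i - n))"

text \<open>The symbol \<open>D\<^sub>i m\<close> is the pair \<open>(i, m)\<close>, regarded as a generator of the free
  \<open>K[t]\<close>-module on all such pairs.\<close>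

definition symbols :: "nat \<Rightarrow> ('k::field poly poly, 'm) module \<Rightarrow> (nat \<times> 'm) set" where
  "symbols k M = {..k} \<times> carrier M"

abbreviation D_symbol :: "nat \<Rightarrow> 'm \<Rightarrow> (nat \<times> 'm) \<Rightarrow>\<^sub>0 'k::field poly" where
  "D_symbol i m \<equiv> Poly_Mapping.single (i, m) 1"

definition prolongation_relations ::
    "nat \<Rightarrow> ('k::field poly poly, 'm) module \<Rightarrow> ((nat \<times> 'm) \<Rightarrow>\<^sub>0 'k poly) set" where
  "prolongation_relations k M =
     {D_symbol i (m1 \<oplus>\<^bsub>M\<^esub> m2) - (D_symbol i m1 + D_symbol i m2) | i m1 m2.
        i \<le> k \<and> m1 \<in> carrier M \<and> m2 \<in> carrier M} \<union>
     {D_symbol i ([:a:] \<odot>\<^bsub>M\<^esub> m) - (\<Sum>j\<le>i. Poly_Mapping.single (i - j, m) (hyperderiv j a)) | i a m.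
        i \<le> k \<and> m \<in> carrier M}"

definition prolongation_submodule ::
    "nat \<Rightarrow> ('k::field poly poly, 'm) module \<Rightarrow> ((nat \<times> 'm) \<Rightarrow>\<^sub>0 'k poly) set" where
  "prolongation_submodule k M =
     left_span (ring_of_type_algebra :: 'k poly ring) (free_module_on (symbols k M))
       (prolongation_relations k M)"

definition prolongation_module ::
    "nat \<Rightarrow> ('k::field poly poly, 'm) module \<Rightarrow> ('k poly, ((nat \<times> 'm) \<Rightarrow>\<^sub>0 'k poly) set) module" where
  "prolongation_module k M =
     quotient_module (free_module_on (symbols k M)) (prolongation_submodule k M)"

text \<open>The semilinear action \<open>\<tau> (a \<cdot> D\<^sub>i m) = a\<^sup>\<tau> \<cdot> D\<^sub>i (\<tau> m)\<close>, first on the free module and then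
  on the quotient.\<close>

definition symbols_tau ::
    "nat \<Rightarrow> ('k::field poly poly, 'm) module \<Rightarrow>
      ((nat \<times> 'm) \<Rightarrow>\<^sub>0 'k poly) \<Rightarrow> ((nat \<times> 'm) \<Rightarrow>\<^sub>0 'k poly)" where
  "symbols_tau q M f =
     (\<Sum>(i, m)\<in>Poly_Mapping.keys f.
        Poly_Mapping.single (i, skew_tau \<odot>\<^bsub>M\<^esub> m) (twist q (Poly_Mapping.lookup f (i, m))))"

definition prolongation_tau ::
    "nat \<Rightarrow> nat \<Rightarrow> ('k::field poly poly, 'm) module \<Rightarrow>
      ((nat \<times> 'm) \<Rightarrow>\<^sub>0 'k poly) set \<Rightarrow> ((nat \<times> 'm) \<Rightarrow>\<^sub>0 'k poly) set" where
  "prolongation_tau q k M C =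
     (\<Union>f\<in>C. prolongation_submodule k M +>\<^bsub>free_module_on (symbols k M)\<^esub> symbols_tau q M f)"

text \<open>The \<open>K[t]{\<tau>}\<close>-module given by a \<open>K[t]\<close>-module and a semilinear map \<open>T\<close> on it:
  \<open>(\<Sum>i. a\<^sub>i \<tau>\<^sup>i) x = \<Sum>i. a\<^sub>i T\<^sup>i x\<close>.\<close>

definition skew_module ::
    "('k::field poly, 'm) module \<Rightarrow> ('m \<Rightarrow> 'm) \<Rightarrow> ('k poly poly, 'm) module" where
  "skew_module N T =
     \<lparr>carrier = carrier N, monoid.mult = undefined, one = undefined,
      ring.zero = \<zero>\<^bsub>N\<^esub>, add = add N,
      module.smult = (\<lambda>P x. finsum N (\<lambda>i. Polynomial.coeff P i \<odot>\<^bsub>N\<^esub> (T ^^ i) x)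
        {..Polynomial.degree P})\<rparr>"

definition prolongation ::
    "nat \<Rightarrow> nat \<Rightarrow> ('k::field poly poly, 'm) module \<Rightarrow>
      ('k poly poly, ((nat \<times> 'm) \<Rightarrow>\<^sub>0 'k poly) set) module" where
  "prolongation q k M = skew_module (prolongation_module k M) (prolongation_tau q k M)"

end

theory Submission
  imports Defs
begin

text \<open>Why a prolongation \<open>P = \<rho>\<^sub>k M\<close> of a \<open>t\<close>-motive \<open>M\<close> is again a \<open>t\<close>-motive. The Leibniz relation
  can be solved for its leading term: with binomial inversion it becomes
  \<open>a \<cdot> D\<^sub>i m = \<Sum>l\<le>i. D\<^sub>l (c\<^sub>l m)\<close> where \<open>c\<^sub>l = (-1)\<^bsup>i-l\<^esup> \<partial>\<^bsup>(i-l)\<^esup>(a)\<close>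
  (\<open>D_coeff\<close>). So each element of \<open>P\<close> is a sum \<open>\<Sum>l\<le>k. D\<^sub>l m\<^sub>l\<close> (\<open>coord_decomposition\<close>).
  The \<open>m\<^sub>l\<close> are unique: reading off the coefficient behind \<open>D\<^sub>l\<close> defines a map \<open>coord l\<close> from the free
  module on the symbols to \<open>M\<close>, the relations are killed by it (\<open>coord_relations\<close>), and so is the
  submodule that they generate (\<open>coord_submodule\<close>), because \<open>coord\<close> is compatible with \<open>K[t]\<close> through
  the Leibniz rule (\<open>coord_smult\<close>). Hence \<open>P\<close> is the direct sum of \<open>k + 1\<close> copies \<open>D\<^sub>l M\<close> of \<open>M\<close>.

  This decomposition is not one of \<open>K[t]\<close>-modules, but it is one of \<open>K{\<tau>}\<close>-modules, since
  \<open>\<tau>\<close> commutes with \<open>D\<^sub>i\<close> by definition and hyperdifferentiation of positive order kills the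
  constants (\<open>D_const_skew_linear\<close>). So a \<open>K{\<tau>}\<close>-basis \<open>B\<close> of \<open>M\<close> yields the basis of all
  \<open>D\<^sub>i b\<close>. Over \<open>K[t]\<close> the Leibniz relation still shows that the \<open>K[t]\<close>-span of the \<open>D\<^sub>i s\<close>, for \<open>s\<close>
  in a set \<open>S\<close>, contains \<open>D\<^sub>i m\<close> for every \<open>m\<close> in the \<open>K[t]\<close>-span of \<open>S\<close> (\<open>D_poly_span\<close>). With
  \<open>S\<close> a finite generating set this is finite generation over \<open>K[t]\<close>. With
  \<open>S = \<tau>(M)\<close> it gives the last condition: \<open>\<partial>\<^bsup>(j)\<^esup>((t - \<theta>)\<^bsup>l+k\<^esup>)\<close> is still divisible by
  \<open>(t - \<theta>)\<^sup>l\<close> for \<open>j \<le> k\<close>, so \<open>(t - \<theta>)\<^bsup>l+k\<^esup> D\<^sub>i m\<close> is a sum of terms \<open>D\<^sub>r m'\<close> with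
  \<open>m'\<close> in \<open>K[t] \<cdot> \<tau>(M)\<close>, each of which lies in \<open>K[t] \<cdot> \<tau>(P)\<close>
  (\<open>linear_power_smult_in_tau_span\<close>).\<close>

section \<open>Left modules: sums, spans and quotients\<close>

lemma finsum_additive_map:
  assumes "abelian_group G" "abelian_group H"
    and h: "h \<in> carrier G \<rightarrow> carrier H"
    and add: "\<And>x y. \<lbrakk>x \<in> carrier G; y \<in> carrier G\<rbrakk> \<Longrightarrow> h (x \<oplus>\<^bsub>G\<^esub> y) = h x \<oplus>\<^bsub>H\<^esub> h y"
    and f: "f \<in> A \<rightarrow> carrier G"
  shows "h (finsum G f A) = finsum H (\<lambda>i. h (f i)) A"
proof -
  interpret G: abelian_group G by fact
  interpret H: abelian_group H by fact
  have "h \<zero>\<^bsub>G\<^esub> \<oplus>\<^bsub>H\<^esub> h \<zero>\<^bsub>G\<^esub> = h \<zero>\<^bsub>G\<^esub> \<oplus>\<^bsub>H\<^esub> \<zero>\<^bsub>H\<^esub>"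
    using add[of "\<zero>\<^bsub>G\<^esub>" "\<zero>\<^bsub>G\<^esub>"] h by (simp add: Pi_iff)
  hence zero: "h \<zero>\<^bsub>G\<^esub> = \<zero>\<^bsub>H\<^esub>"
    using h by (metis G.zero_closed H.add.l_cancel H.zero_closed PiE)
  show ?thesis
    using f
  proof (induction A rule: infinite_finite_induct)
    case (insert x F)
    then have "finsum G f F \<in> carrier G" by (intro G.finsum_closed) auto
    with insert h show ?case
      by (subst G.finsum_insert) (auto simp: add Pi_iff)
  qed (simp_all add: zero)
qed

lemma (in abelian_monoid) finsum_in_closed:
  assumes "W \<subseteq> carrier G" "\<zero> \<in> W" "\<And>x y. \<lbrakk>x \<in> W; y \<in> W\<rbrakk> \<Longrightarrow> x \<oplus> y \<in> W"
    and "f \<in> A \<rightarrow> W"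
  shows "finsum G f A \<in> W"
  using assms(4)
proof (induction A rule: infinite_finite_induct)
  case (insert x F)
  with assms show ?case
    by (subst finsum_insert) (auto simp: Pi_iff)
qed (use assms in simp_all)

context left_module
begin

lemma smult_zero:
  assumes "a \<in> carrier R"
  shows "a \<odot>\<^bsub>M\<^esub> \<zero>\<^bsub>M\<^esub> = \<zero>\<^bsub>M\<^esub>"
  using smult_r_distr[OF assms M.zero_closed M.zero_closed]
    smult_closed[OF assms M.zero_closed]
  by (metis M.add.r_cancel_one M.l_zero M.zero_closed)

lemma zero_smult:
  assumes "x \<in> carrier M"
  shows "\<zero> \<odot>\<^bsub>M\<^esub> x = \<zero>\<^bsub>M\<^esub>"
  using smult_l_distr[OF R.zero_closed R.zero_closed assms]
    smult_closed[OF R.zero_closed assms]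
  by (metis M.add.r_cancel_one R.l_zero R.zero_closed)

lemma minus_one_smult:
  assumes "x \<in> carrier M"
  shows "(\<ominus> \<one>) \<odot>\<^bsub>M\<^esub> x = \<ominus>\<^bsub>M\<^esub> x"
proof (rule M.minus_equality[symmetric])
  show "(\<ominus> \<one>) \<odot>\<^bsub>M\<^esub> x \<oplus>\<^bsub>M\<^esub> x = \<zero>\<^bsub>M\<^esub>"
    using smult_l_distr[of "\<ominus> \<one>" \<one> x] assms
    by (simp add: smult_one zero_smult R.l_neg)
qed (use assms smult_closed in auto)

lemma finsum_smult:
  assumes "a \<in> carrier R" "f \<in> A \<rightarrow> carrier M"
  shows "a \<odot>\<^bsub>M\<^esub> finsum M f A = finsum M (\<lambda>i. a \<odot>\<^bsub>M\<^esub> f i) A"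
  using assms
  by (intro finsum_additive_map)
    (auto simp: smult_r_distr smult_closed M.abelian_group_axioms)

lemma left_span_subset_carrier:
  assumes "S \<subseteq> carrier M"
  shows "left_span R M S \<subseteq> carrier M"
  using assms by (auto simp: left_span_def Pi_iff intro!: M.finsum_closed smult_closed)

lemma left_span_least:
  assumes "W \<subseteq> carrier M" "\<zero>\<^bsub>M\<^esub> \<in> W" "\<And>x y. \<lbrakk>x \<in> W; y \<in> W\<rbrakk> \<Longrightarrow> x \<oplus>\<^bsub>M\<^esub> y \<in> W"
    and "\<And>a x. \<lbrakk>a \<in> carrier R; x \<in> W\<rbrakk> \<Longrightarrow> a \<odot>\<^bsub>M\<^esub> x \<in> W" "S \<subseteq> W"
  shows "left_span R M S \<subseteq> W"
  using assms by (auto simp: left_span_def Pi_iff intro!: M.finsum_in_closed[of W])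

lemma left_spanI:
  assumes "finite A" "A \<subseteq> S" "c \<in> A \<rightarrow> carrier R"
  shows "finsum M (\<lambda>s. c s \<odot>\<^bsub>M\<^esub> s) A \<in> left_span R M S"
  unfolding left_span_def using assms by blast

lemma left_span_zero: "\<zero>\<^bsub>M\<^esub> \<in> left_span R M S"
  unfolding left_span_def
  by (rule CollectI, rule exI[of _ "\<lambda>_. \<zero>"], rule exI[of _ "{}"]) simp

lemma left_span_base:
  assumes "S \<subseteq> carrier M" "s \<in> S"
  shows "s \<in> left_span R M S"
  unfolding left_span_def
  using assms
  by (intro CollectI exI[of _ "\<lambda>_. \<one>"] exI[of _ "{s}"])
    (auto simp: smult_one subset_iff)

lemma left_span_add:
  assumes S: "S \<subseteq> carrier M" and "x \<in> left_span R M S" "y \<in> left_span R M S"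
  shows "x \<oplus>\<^bsub>M\<^esub> y \<in> left_span R M S"
proof -
  from assms obtain c A d B where
    c: "x = finsum M (\<lambda>s. c s \<odot>\<^bsub>M\<^esub> s) A" "finite A" "A \<subseteq> S" "c \<in> A \<rightarrow> carrier R" and
    d: "y = finsum M (\<lambda>s. d s \<odot>\<^bsub>M\<^esub> s) B" "finite B" "B \<subseteq> S" "d \<in> B \<rightarrow> carrier R"
    unfolding left_span_def by blast
  define c' where "c' s = (if s \<in> A then c s else \<zero>)" for s
  define d' where "d' s = (if s \<in> B then d s else \<zero>)" for s
  have c': "c' s \<in> carrier R" and d': "d' s \<in> carrier R" for s
    using c d by (auto simp: c'_def d'_def)
  have sub: "s \<in> carrier M" if "s \<in> A \<union> B" for s using that S c d by auto
  have "x = finsum M (\<lambda>s. c' s \<odot>\<^bsub>M\<^esub> s) (A \<union> B)"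
    unfolding c(1) using c d sub c'
    by (intro M.add.finprod_mono_neutral_cong_left)
      (auto simp: c'_def zero_smult smult_closed Pi_iff)
  moreover have "y = finsum M (\<lambda>s. d' s \<odot>\<^bsub>M\<^esub> s) (A \<union> B)"
    unfolding d(1) using c d sub d'
    by (intro M.add.finprod_mono_neutral_cong_left)
      (auto simp: d'_def zero_smult smult_closed Pi_iff)
  ultimately have "x \<oplus>\<^bsub>M\<^esub> y =
      finsum M (\<lambda>s. c' s \<odot>\<^bsub>M\<^esub> s \<oplus>\<^bsub>M\<^esub> d' s \<odot>\<^bsub>M\<^esub> s) (A \<union> B)"
    using sub c' d' by (simp add: M.finsum_addf Pi_iff smult_closed)
  also have "\<dots> = finsum M (\<lambda>s. (c' s \<oplus> d' s) \<odot>\<^bsub>M\<^esub> s) (A \<union> B)"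
    using sub c' d' by (intro M.finsum_cong') (auto simp: smult_l_distr smult_closed)
  finally show ?thesis
    using c d c' d' left_spanI[of "A \<union> B" S "\<lambda>s. c' s \<oplus> d' s"] by auto
qed

lemma left_span_smult:
  assumes S: "S \<subseteq> carrier M" and "a \<in> carrier R" "x \<in> left_span R M S"
  shows "a \<odot>\<^bsub>M\<^esub> x \<in> left_span R M S"
proof -
  from assms obtain c A where
    c: "x = finsum M (\<lambda>s. c s \<odot>\<^bsub>M\<^esub> s) A" "finite A" "A \<subseteq> S" "c \<in> A \<rightarrow> carrier R"
    unfolding left_span_def by blast
  have sub: "s \<in> carrier M" if "s \<in> A" for s using that S c by auto
  have "a \<odot>\<^bsub>M\<^esub> x = finsum M (\<lambda>s. a \<odot>\<^bsub>M\<^esub> (c s \<odot>\<^bsub>M\<^esub> s)) A"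
    unfolding c(1) using assms c sub by (intro finsum_smult) (auto simp: smult_closed Pi_iff)
  also have "\<dots> = finsum M (\<lambda>s. (a \<otimes> c s) \<odot>\<^bsub>M\<^esub> s) A"
    using assms sub c by (intro M.finsum_cong') (auto simp: smult_assoc smult_closed Pi_iff)
  finally show ?thesis
    using assms(2) c left_spanI[of A S "\<lambda>s. a \<otimes> c s"] by (auto simp: Pi_iff)
qed

lemma left_span_finsum:
  assumes "S \<subseteq> carrier M" "f \<in> A \<rightarrow> left_span R M S"
  shows "finsum M f A \<in> left_span R M S"
  using assms left_span_subset_carrier left_span_zero left_span_add
  by (intro M.finsum_in_closed) auto

lemma restrict_scalars:
  assumes "subring H R"
  shows "left_module (R\<lparr>carrier := H\<rparr>) M"
proof -
  have "H \<subseteq> carrier R" using subringE(1)[OF assms] .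
  then show ?thesis
    using R.subring_is_ring[OF assms] M.abelian_group_axioms
    by (auto simp: left_module_def left_module_axioms_def smult_closed smult_l_distr
        smult_r_distr smult_assoc smult_one subset_iff)
qed

end

locale left_submodule = left_module +
  fixes N
  assumes submodule_subset: "N \<subseteq> carrier M"
    and submodule_zero: "\<zero>\<^bsub>M\<^esub> \<in> N"
    and submodule_add: "\<lbrakk>x \<in> N; y \<in> N\<rbrakk> \<Longrightarrow> x \<oplus>\<^bsub>M\<^esub> y \<in> N"
    and submodule_smult: "\<lbrakk>a \<in> carrier R; x \<in> N\<rbrakk> \<Longrightarrow> a \<odot>\<^bsub>M\<^esub> x \<in> N"

sublocale left_submodule \<subseteq> N: abelian_subgroup N M
proof (rule abelian_subgroupI3)
  have "\<ominus>\<^bsub>M\<^esub> x \<in> N" if "x \<in> N" for x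
    using that submodule_smult[of "\<ominus> \<one>" x] minus_one_smult submodule_subset by auto
  then have "subgroup N (add_monoid M)"
    using submodule_subset submodule_zero submodule_add
    by (intro group.subgroupI[OF M.a_group]) (auto simp: a_inv_def)
  then show "additive_subgroup N M" by (rule additive_subgroup.intro)
qed (rule M.abelian_group_axioms)

context left_submodule
begin

lemma coset_eqI:
  assumes "x \<in> carrier M" "y \<in> carrier M" "x \<ominus>\<^bsub>M\<^esub> y \<in> N"
  shows "N +>\<^bsub>M\<^esub> x = N +>\<^bsub>M\<^esub> y"
proof -
  have "x = (x \<ominus>\<^bsub>M\<^esub> y) \<oplus>\<^bsub>M\<^esub> y"
    using assms by (simp add: M.minus_eq M.a_assoc M.l_neg)
  then have "x \<in> N +>\<^bsub>M\<^esub> y"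
    using assms(3) by (auto simp: a_r_coset_def')
  then show ?thesis
    using assms M.a_repr_independence N.a_subgroup by metis
qed

lemma coset_eqD:
  assumes "x \<in> carrier M" "y \<in> carrier M" "N +>\<^bsub>M\<^esub> x = N +>\<^bsub>M\<^esub> y"
  shows "x \<ominus>\<^bsub>M\<^esub> y \<in> N"
proof -
  have "x \<in> N +>\<^bsub>M\<^esub> y" using N.a_rcos_self[OF assms(1)] assms(3) by simp
  then obtain n where n: "n \<in> N" "x = n \<oplus>\<^bsub>M\<^esub> y" by (auto simp: a_r_coset_def')
  then have "x \<ominus>\<^bsub>M\<^esub> y = n"
    using assms submodule_subset by (auto simp: M.minus_eq M.a_assoc M.r_neg)
  with n show ?thesis by simp
qed

text \<open>An additive map preserving \<open>N\<close> induces a map on cosets, and the union over a coset of the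
  cosets of the images is how that induced map is written: all its members coincide.\<close>

lemma coset_image_Union:
  assumes g: "g \<in> carrier M \<rightarrow> carrier M"
    and add: "\<And>x y. \<lbrakk>x \<in> carrier M; y \<in> carrier M\<rbrakk> \<Longrightarrow> g (x \<oplus>\<^bsub>M\<^esub> y) = g x \<oplus>\<^bsub>M\<^esub> g y"
    and N: "\<And>x. x \<in> N \<Longrightarrow> g x \<in> N"
    and x: "x \<in> carrier M"
  shows "(\<Union>y\<in>N +>\<^bsub>M\<^esub> x. N +>\<^bsub>M\<^esub> g y) = N +>\<^bsub>M\<^esub> g x"
proof -
  have "N +>\<^bsub>M\<^esub> g y = N +>\<^bsub>M\<^esub> g x" if "y \<in> N +>\<^bsub>M\<^esub> x" for y
  proof -
    from that obtain n where n: "n \<in> N" "y = n \<oplus>\<^bsub>M\<^esub> x" by (auto simp: a_r_coset_def')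
    have nc: "n \<in> carrier M" "g n \<in> carrier M" "g x \<in> carrier M"
      using n g x submodule_subset by auto
    then have "g y \<ominus>\<^bsub>M\<^esub> g x = g n"
      using n x by (simp add: add M.minus_eq M.a_assoc M.r_neg)
    then show ?thesis
      using N[OF n(1)] g x n nc by (intro coset_eqI) auto
  qed
  then show ?thesis
    by (intro UN_constant_eq[OF N.a_rcos_self[OF x]] ballI)
qed

lemma quotient_carrier: "carrier (quotient_module M N) = (\<lambda>x. N +>\<^bsub>M\<^esub> x) ` carrier M"
  by (auto simp: quotient_module_def A_RCOSETS_def')

lemma quotient_zero: "\<zero>\<^bsub>quotient_module M N\<^esub> = N +>\<^bsub>M\<^esub> \<zero>\<^bsub>M\<^esub>"
  using M.a_coset_add_zero[OF submodule_subset] by (simp add: quotient_module_def)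

lemma quotient_add:
  assumes "x \<in> carrier M" "y \<in> carrier M"
  shows "(N +>\<^bsub>M\<^esub> x) \<oplus>\<^bsub>quotient_module M N\<^esub> (N +>\<^bsub>M\<^esub> y) = N +>\<^bsub>M\<^esub> (x \<oplus>\<^bsub>M\<^esub> y)"
  using N.a_rcos_sum[OF assms] by (simp add: quotient_module_def)

lemma quotient_smult:
  assumes "a \<in> carrier R" "x \<in> carrier M"
  shows "a \<odot>\<^bsub>quotient_module M N\<^esub> (N +>\<^bsub>M\<^esub> x) = N +>\<^bsub>M\<^esub> (a \<odot>\<^bsub>M\<^esub> x)"
  using assms coset_image_Union[of "\<lambda>x. a \<odot>\<^bsub>M\<^esub> x"]
  by (simp add: quotient_module_def smult_closed smult_r_distr submodule_smult)

lemma quotient_left_module: "left_module R (quotient_module M N)"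
proof -
  let ?Q = "quotient_module M N"
  have "abelian_group ?Q"
  proof (rule abelian_groupI)
    fix C assume "C \<in> carrier ?Q"
    then obtain x where x: "x \<in> carrier M" "C = N +>\<^bsub>M\<^esub> x" by (auto simp: quotient_carrier)
    then show "\<exists>Y\<in>carrier ?Q. Y \<oplus>\<^bsub>?Q\<^esub> C = \<zero>\<^bsub>?Q\<^esub>"
      by (intro bexI[of _ "N +>\<^bsub>M\<^esub> (\<ominus>\<^bsub>M\<^esub> x)"])
        (auto simp: quotient_add quotient_zero quotient_carrier M.l_neg)
  qed (auto simp: quotient_carrier quotient_add quotient_zero M.a_ac)
  then show ?thesis
    using R.ring_axioms
    by (auto simp: left_module_def left_module_axioms_def quotient_carrier quotient_add
        quotient_smult smult_closed smult_l_distr smult_r_distr smult_assoc smult_one)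
qed

end

section \<open>Hyperdifferential operators\<close>

lemma coeff_hyperderiv:
  "Polynomial.coeff (hyperderiv n a) m = of_nat (m + n choose n) * Polynomial.coeff a (m + n)"
proof -
  have "Polynomial.coeff (hyperderiv n a) m =
      (\<Sum>i\<le>Polynomial.degree a. if i = m + n then of_nat (i choose n) * Polynomial.coeff a i else 0)"
    unfolding hyperderiv_def coeff_sum
  proof (intro sum.cong refl)
    fix i
    show "Polynomial.coeff (Polynomial.monom (of_nat (i choose n) * Polynomial.coeff a i) (i - n)) m =
        (if i = m + n then of_nat (i choose n) * Polynomial.coeff a i else 0)"
      by (cases "n \<le> i") (auto simp: binomial_eq_0)
  qed
  then show ?thesis
    by (simp add: coeff_eq_0)
qed

lemma hyperderiv_add: "hyperderiv n (a + b) = hyperderiv n a + hyperderiv n b"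
  by (rule poly_eqI) (simp add: coeff_hyperderiv algebra_simps)

lemma hyperderiv_smult: "hyperderiv n (Polynomial.smult c a) = Polynomial.smult c (hyperderiv n a)"
  by (rule poly_eqI) (simp add: coeff_hyperderiv)

lemma hyperderiv_zero [simp]: "hyperderiv n 0 = 0"
  by (rule poly_eqI) (simp add: coeff_hyperderiv)

lemma hyperderiv_0 [simp]: "hyperderiv 0 a = a"
  by (rule poly_eqI) (simp add: coeff_hyperderiv)

lemma hyperderiv_const: "hyperderiv n [:c:] = (if n = 0 then [:c:] else 0)"
  by (rule poly_eqI) (auto simp: coeff_hyperderiv coeff_pCons split: nat.splits)

lemma hyperderiv_pCons_0:
  "hyperderiv (Suc n) (pCons 0 a) = pCons 0 (hyperderiv (Suc n) a) + hyperderiv n a"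
proof (rule poly_eqI)
  fix m
  show "Polynomial.coeff (hyperderiv (Suc n) (pCons 0 a)) m =
      Polynomial.coeff (pCons 0 (hyperderiv (Suc n) a) + hyperderiv n a) m"
    by (cases m) (simp_all add: coeff_hyperderiv algebra_simps)
qed

lemma hyperderiv_hyperderiv:
  "hyperderiv m (hyperderiv n a) = of_nat (m + n choose m) * hyperderiv (m + n) a"
proof (rule poly_eqI)
  fix i
  have "(i + m choose m) * (i + m + n choose n) = (m + n choose m) * (i + m + n choose (m + n))"
    using choose_mult[of n "m + n" "i + m + n"] binomial_symmetric[of m "m + n"]
    by (simp add: ac_simps)
  then have "of_nat (i + m choose m) * (of_nat (i + m + n choose n) :: 'a) =
      of_nat (m + n choose m) * of_nat (i + m + n choose (m + n))"
    by (metis of_nat_mult)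
  then show "Polynomial.coeff (hyperderiv m (hyperderiv n a)) i =
      Polynomial.coeff (of_nat (m + n choose m) * hyperderiv (m + n) a) i"
    by (simp add: coeff_hyperderiv of_nat_poly add.assoc mult.assoc[symmetric])
qed

text \<open>The Leibniz rule. By additivity it suffices to treat constants and multiples of \<open>t\<close>, and
  for the latter Pascal's rule in the form of \<open>hyperderiv_pCons_0\<close> reduces the degree.\<close>

lemma hyperderiv_mult:
  "hyperderiv n (a * b) = (\<Sum>j\<le>n. hyperderiv j a * hyperderiv (n - j) b)"
proof (induction a arbitrary: n)
  case (pCons c a)
  have decomp: "hyperderiv j (pCons c a) = hyperderiv j [:c:] + hyperderiv j (pCons 0 a)" for j
    unfolding hyperderiv_add[symmetric] by simp
  have shift_mult: "pCons 0 p = Polynomial.monom 1 1 * p" for p :: "'a poly"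
    by (simp add: Polynomial.monom_Suc)
  have const: "(\<Sum>j\<le>n. hyperderiv j [:c:] * hyperderiv (n - j) b) = Polynomial.smult c (hyperderiv n b)"
    by (subst sum.remove[of _ 0]) (auto simp: hyperderiv_const)
  have shift: "hyperderiv n (pCons 0 (a * b)) =
      (\<Sum>j\<le>n. hyperderiv j (pCons 0 a) * hyperderiv (n - j) b)"
  proof (cases n)
    case (Suc m)
    have "hyperderiv n (pCons 0 (a * b)) = pCons 0 (hyperderiv (Suc m) (a * b)) + hyperderiv m (a * b)"
      by (simp add: Suc hyperderiv_pCons_0)
    also have "pCons 0 (hyperderiv (Suc m) (a * b)) = 
        (\<Sum>j\<le>Suc m. pCons 0 (hyperderiv j a) * hyperderiv (Suc m - j) b)"
      by (simp only: pCons.IH shift_mult sum_distrib_left mult.assoc)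
    also have "\<dots> = pCons 0 a * hyperderiv (Suc m) b +
        (\<Sum>j\<le>m. pCons 0 (hyperderiv (Suc j) a) * hyperderiv (m - j) b)"
      by (subst sum.atMost_Suc_shift) simp
    also have "hyperderiv m (a * b) = (\<Sum>j\<le>m. hyperderiv j a * hyperderiv (m - j) b)"
      by (rule pCons.IH)
    finally show ?thesis
      unfolding Suc
      by (subst sum.atMost_Suc_shift)
        (simp add: hyperderiv_pCons_0 sum.distrib[symmetric] algebra_simps)
  qed simp
  show ?case
    unfolding mult_pCons_left
    by (simp only: hyperderiv_add hyperderiv_smult shift const[symmetric] sum.distrib[symmetric]
        distrib_right[symmetric] decomp[symmetric])
qed simp

text \<open>By the Leibniz rule, one hyperdifferentiation of order \<open>j\<close> removes at most \<open>j\<close> of the factors: applied to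
  \<open>(t + c) b\<close> it leaves the factor \<open>t + c\<close> alone except in one term, of order \<open>j - 1\<close> in \<open>b\<close>.\<close>

lemma linear_power_dvd_hyperderiv:
  "[:c, 1:] ^ (n - j) dvd hyperderiv j ([:c, 1:] ^ n)"
proof (induction n arbitrary: j)
  case 0
  show ?case by simp
next
  case (Suc n)
  show ?case
  proof (cases j)
    case (Suc i)
    have "[:c, 1:] * p = Polynomial.smult c p + pCons 0 p" for p :: "'a poly" by simp
    then have "hyperderiv j ([:c, 1:] ^ Suc n) =
        [:c, 1:] * hyperderiv j ([:c, 1:] ^ n) + hyperderiv i ([:c, 1:] ^ n)"
      by (simp only: power_Suc hyperderiv_add hyperderiv_smult Suc hyperderiv_pCons_0 add.assoc)
    moreover have "[:c, 1:] ^ (Suc n - j) dvd [:c, 1:] * hyperderiv j ([:c, 1:] ^ n)"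
    proof (cases "j \<le> n")
      case True
      then show ?thesis
        using mult_dvd_mono[OF dvd_refl Suc.IH[of j], of "[:c, 1:]"]
        by (simp only: Suc_diff_le power_Suc)
    qed simp
    moreover have "[:c, 1:] ^ (Suc n - j) dvd hyperderiv i ([:c, 1:] ^ n)"
      using Suc.IH[of i] Suc by simp
    ultimately show ?thesis by (simp only: dvd_add)
  qed simp
qed

text \<open>In a prolongation, solving \<open>D\<^sub>i(a m) = \<Sum>j. \<partial>\<^sup>(\<^sup>j\<^sup>)(a) \<cdot> D\<^bsub>i-j\<^esub> m\<close> for \<open>a \<cdot> D\<^sub>i m\<close>
  yields \<open>a \<cdot> D\<^sub>i m = \<Sum>l\<le>i. D\<^sub>l (c\<^sub>l m)\<close>; the coefficient \<open>c\<^sub>l\<close> is \<open>D_coeff l i a\<close>. For example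
  \<open>t \<cdot> D\<^sub>i m = D\<^sub>i (t m) - D\<^bsub>i-1\<^esub> m\<close>.\<close>

definition D_coeff :: "nat \<Rightarrow> nat \<Rightarrow> 'k::field poly \<Rightarrow> 'k poly" where
  "D_coeff l i a = (if l \<le> i then (-1) ^ (i - l) * hyperderiv (i - l) a else 0)"

lemma D_coeff_add: "D_coeff l i (a + b) = D_coeff l i a + D_coeff l i b"
  by (simp add: D_coeff_def hyperderiv_add distrib_left)

lemma D_coeff_zero [simp]: "D_coeff l i 0 = 0"
  by (simp add: D_coeff_def)

lemma D_coeff_const: "D_coeff l i [:c:] = (if l = i then [:c:] else 0)"
  by (auto simp: D_coeff_def hyperderiv_const)

lemma D_coeff_one: "D_coeff l i 1 = (if l = i then 1 else 0)"
  by (simp only: one_pCons D_coeff_const)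

text \<open>\<open>(a b) \<cdot> D\<^sub>i m = a \<cdot> (b \<cdot> D\<^sub>i m)\<close> in terms of coordinates: it is the Leibniz rule, as the
  signs are multiplicative along \<open>l \<le> j \<le> i\<close>.\<close>

lemma D_coeff_mult:
  assumes "i \<le> k"
  shows "D_coeff l i (a * b) = (\<Sum>j\<le>k. D_coeff l j a * D_coeff j i b)"
proof (cases "l \<le> i")
  case True
  have "(\<Sum>j\<le>k. D_coeff l j a * D_coeff j i b) = (\<Sum>j\<in>{l..i}. D_coeff l j a * D_coeff j i b)"
    using assms by (intro sum.mono_neutral_right) (auto simp: D_coeff_def)
  also have "\<dots> = (\<Sum>j\<in>{l..i}. (-1) ^ (i - l) * (hyperderiv (j - l) a * hyperderiv (i - j) b))"
  proof (intro sum.cong refl)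
    fix j assume "j \<in> {l..i}"
    then have "i - l = (j - l) + (i - j)" "l \<le> j" "j \<le> i" by auto
    then show "D_coeff l j a * D_coeff j i b =
        (-1) ^ (i - l) * (hyperderiv (j - l) a * hyperderiv (i - j) b)"
      by (simp only: D_coeff_def power_add if_True ac_simps)
  qed
  also have "\<dots> = (\<Sum>j\<le>i - l. (-1) ^ (i - l) * (hyperderiv j a * hyperderiv (i - l - j) b))"
    using True by (intro sum.reindex_bij_witness[of _ "\<lambda>j. j + l" "\<lambda>j. j - l"]) auto
  finally show ?thesis
    using True by (simp add: D_coeff_def hyperderiv_mult sum_distrib_left)
next
  case False
  then have "(\<Sum>j\<le>k. D_coeff l j a * D_coeff j i b) = 0"
    by (intro sum.neutral) (auto simp: D_coeff_def)
  with False show ?thesis by (simp add: D_coeff_def)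
qed

text \<open>Composing hyperdifferential operators of total order \<open>n\<close> yields binomial multiples of
  \<open>\<partial>\<^bsup>(n)\<^esup>\<close>, and the alternating sum of the \<open>n\<close>-th row of binomial coefficients vanishes for
  \<open>n > 0\<close>. This makes the triangular systems \<open>\<partial>\<^bsup>(i-l)\<^esup>\<close> and \<open>D_coeff l i\<close> inverse to each other; the next
  two lemmas are the two orders of composition.\<close>

lemma alternating_hyperderiv_sum:
  "(\<Sum>j\<le>n. (-1) ^ (n - j) * hyperderiv (n - j) (hyperderiv j a)) = (if n = 0 then a else 0)"
proof -
  have "(\<Sum>j\<le>n. (-1) ^ (n - j) * hyperderiv (n - j) (hyperderiv j a)) =
      (\<Sum>j\<le>n. (-1) ^ (n - j) * of_nat (n choose (n - j))) * hyperderiv n a"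
    by (simp add: hyperderiv_hyperderiv sum_distrib_right mult.assoc)
  also have "(\<Sum>j\<le>n. (-1) ^ (n - j) * of_nat (n choose (n - j)) :: 'a poly) =
      (\<Sum>j\<le>n. (-1) ^ j * of_nat (n choose j))"
    by (rule sum.reindex_bij_witness[of _ "\<lambda>j. n - j" "\<lambda>j. n - j"]) auto
  also have "\<dots> = (if n = 0 then 1 else 0)"
    by (simp add: choose_alternating_sum)
  finally show ?thesis by simp
qed

lemma D_coeff_hyperderiv_sum:
  "(\<Sum>j\<le>i. D_coeff l (i - j) (hyperderiv j a)) = (if l = i then a else 0)"
proof (cases "l \<le> i")
  case True
  have "(\<Sum>j\<le>i. D_coeff l (i - j) (hyperderiv j a)) =
      (\<Sum>j\<le>i - l. D_coeff l (i - j) (hyperderiv j a))"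
    using True by (intro sum.mono_neutral_right) (auto simp: D_coeff_def)
  also have "\<dots> = (\<Sum>j\<le>i - l. (-1) ^ (i - l - j) * hyperderiv (i - l - j) (hyperderiv j a))"
  proof (intro sum.cong refl)
    fix j assume "j \<in> {..i - l}"
    with True have "i - j - l = i - l - j" "l \<le> i - j" by auto
    then show "D_coeff l (i - j) (hyperderiv j a) =
        (-1) ^ (i - l - j) * hyperderiv (i - l - j) (hyperderiv j a)"
      by (simp add: D_coeff_def)
  qed
  also have "\<dots> = (if i - l = 0 then a else 0)"
    by (rule alternating_hyperderiv_sum)
  finally show ?thesis
    using True by auto
next
  case False
  then have "D_coeff l (i - j) (hyperderiv j a) = 0" for j by (simp add: D_coeff_def)
  with False show ?thesis by auto
qed

lemma hyperderiv_D_coeff_sum: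
  assumes "r \<le> i"
  shows "(\<Sum>l\<in>{r..i}. hyperderiv (l - r) (D_coeff l i a)) = (if r = i then a else 0)"
proof -
  have minus: "hyperderiv n ((-1) ^ s * b) = (-1) ^ s * hyperderiv n b" for n s and b :: "'a poly"
    by (induction s) (simp_all add: hyperderiv_smult[of _ "-1", simplified])
  have "(\<Sum>l\<in>{r..i}. hyperderiv (l - r) (D_coeff l i a)) =
      (\<Sum>l\<in>{r..i}. (-1) ^ (i - l) * (of_nat (i - r choose (i - l)) * hyperderiv (i - r) a))"
  proof (intro sum.cong refl)
    fix l assume "l \<in> {r..i}"
    then have "l \<le> i" "l - r + (i - l) = i - r" "i - r - (l - r) = i - l" "l - r \<le> i - r" by auto
    then show "hyperderiv (l - r) (D_coeff l i a) =
        (-1) ^ (i - l) * (of_nat (i - r choose (i - l)) * hyperderiv (i - r) a)"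
      using binomial_symmetric[of "l - r" "i - r"]
      by (simp add: D_coeff_def minus hyperderiv_hyperderiv)
  qed
  also have "\<dots> = (\<Sum>j\<le>i - r. (-1) ^ j * of_nat (i - r choose j)) * hyperderiv (i - r) a"
    unfolding sum_distrib_right mult.assoc using assms
    by (intro sum.reindex_bij_witness[of _ "\<lambda>j. i - j" "\<lambda>l. i - l"]) auto
  also have "(\<Sum>j\<le>i - r. (-1) ^ j * of_nat (i - r choose j) :: 'a poly) = (if i - r = 0 then 1 else 0)"
    by (simp add: choose_alternating_sum)
  finally show ?thesis using assms by simp
qed

lemma linear_power_dvd_D_coeff:
  assumes "i \<le> k"
  shows "[:c, 1:] ^ l dvd D_coeff r i ([:c, 1:] ^ (l + k))"
proof (cases "r \<le> i")
  case True
  have "[:c, 1:] ^ l dvd [:c, 1:] ^ (l + k - (i - r))"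
    using assms by (intro le_imp_power_dvd) auto
  also have "\<dots> dvd hyperderiv (i - r) ([:c, 1:] ^ (l + k))"
    by (rule linear_power_dvd_hyperderiv)
  finally show ?thesis
    using True by (simp add: D_coeff_def)
qed (simp add: D_coeff_def)

section \<open>The skew polynomial ring\<close>

lemma skew_poly_ring_simps:
  "carrier (skew_poly_ring q) = UNIV" "\<one>\<^bsub>skew_poly_ring q\<^esub> = 1" "\<zero>\<^bsub>skew_poly_ring q\<^esub> = 0"
  "P \<oplus>\<^bsub>skew_poly_ring q\<^esub> Q = P + Q"
  by (simp_all add: skew_poly_ring_def)

lemma skew_mult_eq:
  "P \<otimes>\<^bsub>skew_poly_ring q\<^esub> Q = (\<Sum>i\<le>Polynomial.degree P. \<Sum>j\<le>Polynomial.degree Q.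
    Polynomial.monom (Polynomial.coeff P i * (twist q ^^ i) (Polynomial.coeff Q j)) (i + j))"
  by (simp add: skew_poly_ring_def)

lemma type_ring_simps:
  "carrier (ring_of_type_algebra :: 'a::ring_1 ring) = UNIV"
  "\<one>\<^bsub>ring_of_type_algebra\<^esub> = (1 :: 'a)" "\<zero>\<^bsub>ring_of_type_algebra\<^esub> = (0 :: 'a)"
  "a \<oplus>\<^bsub>ring_of_type_algebra\<^esub> b = a + (b :: 'a)" "a \<otimes>\<^bsub>ring_of_type_algebra\<^esub> b = a * (b :: 'a)"
  by (simp_all add: ring_of_type_algebra_def)

text \<open>That \<open>K[t]{\<tau>}\<close> is a ring encodes that the twist \<open>a \<mapsto> a\<^sup>\<tau>\<close> is a ring endomorphism of
  \<open>K[t]\<close>: distributivity and associativity, applied to \<open>\<tau>\<close> and two elements of \<open>K[t]\<close>, say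
  exactly that it is additive and multiplicative. The parameter \<open>field_type\<close> fixes \<open>K\<close>, which \<open>q\<close> alone
  does not determine.\<close>

locale skew_ring =
  fixes q :: nat and field_type :: "'k::field itself"
  assumes q_pos: "0 < q"
    and ring: "ring (skew_poly_ring q :: 'k poly poly ring)"
begin

abbreviation S :: "'k poly poly ring" where "S \<equiv> skew_poly_ring q"

lemma coeff_twist: "Polynomial.coeff (twist q a) i = Polynomial.coeff a i ^ q" for a :: "'k poly"
  using q_pos by (simp add: twist_def coeff_map_poly)

lemma twist_zero [simp]: "twist q 0 = (0 :: 'k poly)"
  by (simp add: twist_def)

lemma twist_one [simp]: "twist q 1 = (1 :: 'k poly)"
  using q_pos by (simp add: twist_def)

lemma twist_pow_zero [simp]: "(twist q ^^ i) 0 = (0 :: 'k poly)"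
  by (induction i) simp_all

lemma twist_pow_one [simp]: "(twist q ^^ i) 1 = (1 :: 'k poly)"
  by (induction i) simp_all

lemma skew_mult_const: "[:a:] \<otimes>\<^bsub>S\<^esub> P = Polynomial.smult a P"
  by (rule poly_eqI) (auto simp: skew_poly_ring_def coeff_sum coeff_eq_0)

lemma skew_mult_tau: "P \<otimes>\<^bsub>S\<^esub> skew_tau = pCons 0 P"
proof -
  have "P \<otimes>\<^bsub>S\<^esub> skew_tau =
      (\<Sum>i\<le>Polynomial.degree P. pCons 0 (Polynomial.monom (Polynomial.coeff P i) i))"
    by (simp add: skew_poly_ring_def Polynomial.degree_monom_eq Polynomial.monom_Suc)
  also have "\<dots> = pCons 0 (\<Sum>i\<le>Polynomial.degree P. Polynomial.monom (Polynomial.coeff P i) i)"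
    by (rule poly_eqI) (auto simp: coeff_sum coeff_pCons split: nat.splits)
  finally show ?thesis by (simp add: poly_as_sum_of_monoms)
qed

lemma skew_tau_const: "skew_tau \<otimes>\<^bsub>S\<^esub> [:a:] = Polynomial.monom (twist q a) 1"
  by (simp add: skew_poly_ring_def Polynomial.degree_monom_eq)

lemma twist_add: "twist q (a + b) = twist q a + twist q (b :: 'k poly)"
proof -
  interpret ring S by (rule ring)
  have "Polynomial.monom (twist q (a + b)) 1 = Polynomial.monom (twist q a + twist q b) (1::nat)"
    using r_distr[of "[:a:]" "[:b:]" skew_tau]
    by (simp add: skew_poly_ring_simps skew_tau_const add_monom del: One_nat_def)
  then show ?thesis by (simp only: monom_eq_iff)
qed

lemma twist_mult: "twist q (a * b) = twist q a * twist q (b :: 'k poly)"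
proof -
  interpret ring S by (rule ring)
  have tau: "Polynomial.monom c 1 \<otimes>\<^bsub>S\<^esub> [:b:] = Polynomial.monom (c * twist q b) 1" for c
    by (cases "c = 0") (simp_all add: skew_poly_ring_def Polynomial.degree_monom_eq)
  have "Polynomial.monom (twist q (a * b)) 1 = Polynomial.monom (twist q a * twist q b) (1::nat)"
    using m_assoc[of skew_tau "[:a:]" "[:b:]"]
    by (simp add: skew_poly_ring_simps skew_tau_const skew_mult_const tau del: One_nat_def)
  then show ?thesis by (simp only: monom_eq_iff)
qed

lemma twist_minus: "twist q (- a) = - twist q (a :: 'k poly)"
  using twist_add[of a "- a"] by (simp add: eq_neg_iff_add_eq_0 add.commute)

lemma twist_of_nat: "twist q (of_nat n) = (of_nat n :: 'k poly)"
  by (induction n) (simp_all add: twist_add)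

text \<open>The twist fixes the image of \<open>\<nat>\<close>, in particular all binomial coefficients. Hence it commutes with
  the hyperdifferential operators, which makes \<open>\<tau>\<close> on the prolongation well defined.\<close>

lemma of_nat_power_q: "(of_nat n :: 'k) ^ q = of_nat n"
  using coeff_twist[of "of_nat n" 0] unfolding twist_of_nat by (simp add: of_nat_poly)

lemma twist_hyperderiv: "twist q (hyperderiv n a) = hyperderiv n (twist q (a :: 'k poly))"
  by (rule poly_eqI) (simp add: coeff_twist coeff_hyperderiv power_mult_distrib of_nat_power_q)

lemma twist_D_coeff: "twist q (D_coeff l i a) = D_coeff l i (twist q (a :: 'k poly))"
proof -
  have "twist q ((-1) ^ s * b) = (-1) ^ s * twist q (b :: 'k poly)" for s b
    by (induction s) (simp_all add: twist_minus)
  then show ?thesis by (simp add: D_coeff_def twist_hyperderiv)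
qed

lemma a_inv_skew: "\<ominus>\<^bsub>S\<^esub> P = - P"
proof -
  interpret ring S by (rule ring)
  show ?thesis
    using minus_equality[of "- P" P] by (simp add: skew_poly_ring_simps)
qed

lemma subring_poly: "subring (range (\<lambda>a. [:a:])) S"
proof -
  interpret ring S by (rule ring)
  show ?thesis
    by (rule subringI)
      (auto simp: skew_poly_ring_simps skew_mult_const a_inv_skew one_pCons image_iff)
qed

lemma subring_const: "subring {P. \<forall>i. \<exists>x. Polynomial.coeff P i = [:x:]} S"
proof -
  interpret ring S by (rule ring)
  define C where "C = range (\<lambda>x. [:x:] :: 'k poly)"
  have add: "a + b \<in> C" and mult: "a * b \<in> C" if "a \<in> C" "b \<in> C" for a b
    using that by (auto simp: C_def image_iff)
  have minus: "- a \<in> C" if "a \<in> C" for a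
    using that by (auto simp: C_def image_iff)
  have zero: "0 \<in> C" and one: "1 \<in> C"
    unfolding C_def by (rule range_eqI[of _ _ 0], simp, rule range_eqI[of _ _ 1], simp)
  have sum: "sum f A \<in> C" if "\<And>i. i \<in> A \<Longrightarrow> f i \<in> C" for f and A :: "nat set"
    using that by (induction A rule: infinite_finite_induct) (auto intro: zero add)
  have twist: "(twist q ^^ i) a \<in> C" if "a \<in> C" for a i
  proof -
    have "twist q [:x:] = [:x ^ q:]" for x :: 'k
      using q_pos by (simp add: twist_def map_poly_pCons)
    with that show ?thesis by (induction i) (auto simp: C_def)
  qed
  have eq: "{P. \<forall>i. \<exists>x. Polynomial.coeff P i = [:x:]} = {P. \<forall>i. Polynomial.coeff P i \<in> C}"
    by (auto simp: C_def)
  show ?thesis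
    unfolding eq
  proof (rule subringI)
    show "\<one>\<^bsub>S\<^esub> \<in> {P. \<forall>i. Polynomial.coeff P i \<in> C}"
      by (auto simp: skew_poly_ring_simps one_pCons coeff_pCons one[unfolded one_pCons] zero split: nat.splits)
  qed (auto simp: skew_poly_ring_simps skew_mult_eq coeff_sum a_inv_skew
      intro!: add minus sum mult twist zero)
qed

lemma poly_subring_eq: "poly_subring q = S\<lparr>carrier := range (\<lambda>a. [:a:])\<rparr>"
  by (simp add: poly_subring_def full_SetCompr_eq)

lemma left_module_poly_subring:
  assumes "left_module S M"
  shows "left_module (poly_subring q) M"
  unfolding poly_subring_eq
  by (rule left_module.restrict_scalars[OF assms subring_poly])

lemma left_module_const_skew_subring:
  assumes "left_module S M"
  shows "left_module (const_skew_subring q) M"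
  unfolding const_skew_subring_def
  by (rule left_module.restrict_scalars[OF assms subring_const])

lemma carrier_poly_subring: "carrier (poly_subring q :: 'k poly poly ring) = range (\<lambda>a. [:a:])"
  by (simp add: poly_subring_eq)

lemma carrier_const_skew_subring:
  "carrier (const_skew_subring q :: 'k poly poly ring) =
    {P. \<forall>i. \<exists>x. Polynomial.coeff P i = [:x:]}"
  by (simp add: const_skew_subring_def)

text \<open>The constants and \<open>\<tau>\<close> generate \<open>K{\<tau>}\<close>. The induction peels off the constant term of a skew
  polynomial: the remaining part is \<open>Q \<tau>\<close> with \<open>Q\<close> of smaller degree, and \<open>Q\<close> then acts on \<open>\<tau> x\<close>.\<close>

lemma const_skew_linear:
  assumes "left_module S M" "left_module S N"
    and h: "h \<in> carrier M \<rightarrow> carrier N"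
    and add: "\<And>x y. \<lbrakk>x \<in> carrier M; y \<in> carrier M\<rbrakk> \<Longrightarrow> h (x \<oplus>\<^bsub>M\<^esub> y) = h x \<oplus>\<^bsub>N\<^esub> h y"
    and tau: "\<And>x. x \<in> carrier M \<Longrightarrow> h (skew_tau \<odot>\<^bsub>M\<^esub> x) = skew_tau \<odot>\<^bsub>N\<^esub> h x"
    and const: "\<And>c x. x \<in> carrier M \<Longrightarrow> h ([:[:c:]:] \<odot>\<^bsub>M\<^esub> x) = [:[:c:]:] \<odot>\<^bsub>N\<^esub> h x"
    and P: "P \<in> carrier (const_skew_subring q)" and x: "x \<in> carrier M"
  shows "h (P \<odot>\<^bsub>M\<^esub> x) = P \<odot>\<^bsub>N\<^esub> h x"
proof -
  interpret M: left_module S M by fact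
  interpret N: left_module S N by fact
  have P': "\<forall>i. \<exists>c. Polynomial.coeff P i = [:c:]" using P by (simp add: carrier_const_skew_subring)
  have decomp: "pCons a Q = [:a:] \<oplus>\<^bsub>S\<^esub> (Q \<otimes>\<^bsub>S\<^esub> skew_tau)" for a Q
    by (simp add: skew_mult_tau skew_poly_ring_simps del: One_nat_def)
  have carrier [simp]: "R \<in> carrier S" for R by (simp add: skew_poly_ring_simps)
  note [simp del] = skew_poly_ring_simps One_nat_def
  show ?thesis
    using P' x
  proof (induction P arbitrary: x)
    case 0
    have "h \<zero>\<^bsub>M\<^esub> = \<zero>\<^bsub>N\<^esub>"
      using finsum_additive_map[OF M.M.abelian_group_axioms N.M.abelian_group_axioms h add,
          of "\<lambda>_. x" "{}"] by simp
    with 0 h show ?case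
      using M.zero_smult[of x] N.zero_smult[of "h x"] by (simp add: skew_poly_ring_simps Pi_iff)
  next
    case (pCons a Q)
    obtain c where c: "a = [:c:]" using pCons.prems(1)[rule_format, of 0] by auto
    have Q: "\<forall>i. \<exists>c. Polynomial.coeff Q i = [:c:]"
    proof
      show "\<exists>c. Polynomial.coeff Q i = [:c:]" for i
        using pCons.prems(1)[rule_format, of "Suc i"] by simp
    qed
    let ?y = "skew_tau \<odot>\<^bsub>M\<^esub> x"
    have y: "?y \<in> carrier M" "h x \<in> carrier N" using pCons.prems h by (auto simp: Pi_iff M.smult_closed)
    have "h (pCons a Q \<odot>\<^bsub>M\<^esub> x) = h ([:a:] \<odot>\<^bsub>M\<^esub> x \<oplus>\<^bsub>M\<^esub> Q \<odot>\<^bsub>M\<^esub> ?y)"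
      using pCons.prems by (subst decomp[of a Q]) (simp add: M.smult_l_distr M.smult_assoc)
    also have "\<dots> = [:a:] \<odot>\<^bsub>N\<^esub> h x \<oplus>\<^bsub>N\<^esub> Q \<odot>\<^bsub>N\<^esub> (skew_tau \<odot>\<^bsub>N\<^esub> h x)"
      using pCons.prems y by (simp add: add c const pCons.IH[OF Q] tau M.smult_closed)
    also have "\<dots> = pCons a Q \<odot>\<^bsub>N\<^esub> h x"
      using y by (subst decomp[of a Q]) (simp add: N.smult_l_distr N.smult_assoc)
    finally show ?case .
  qed
qed

end

section \<open>Prolongation frames\<close>

text \<open>What is needed of a prolongation \<open>P\<close> of \<open>M\<close>: the maps \<open>D\<^sub>0, \<dots>, D\<^sub>k\<close> exhibit \<open>P\<close> as a direct sum
  of copies of \<open>M\<close>, with projections \<open>\<psi>\<^sub>l\<close>. They commute with \<open>\<tau>\<close>, and with \<open>K[t]\<close> up to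
  the two mutually inverse triangular substitutions \<open>D_smult\<close> and \<open>D_leibniz\<close>.\<close>

locale prolongation_frame =
  skew_ring q field_type + M: left_module "skew_poly_ring q" M + P: left_module "skew_poly_ring q" P
  for q and field_type :: "'k::field itself"
    and M :: "('k poly poly, 'm) module" and P :: "('k poly poly, 'p) module" +
  fixes k :: nat and D :: "nat \<Rightarrow> 'm \<Rightarrow> 'p" and \<psi> :: "nat \<Rightarrow> 'p \<Rightarrow> 'm"
  assumes D_closed: "\<lbrakk>i \<le> k; m \<in> carrier M\<rbrakk> \<Longrightarrow> D i m \<in> carrier P"
    and D_add: "\<lbrakk>i \<le> k; m \<in> carrier M; m' \<in> carrier M\<rbrakk> \<Longrightarrow> D i (m \<oplus>\<^bsub>M\<^esub> m') = D i m \<oplus>\<^bsub>P\<^esub> D i m'"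
    and D_tau: "\<lbrakk>i \<le> k; m \<in> carrier M\<rbrakk> \<Longrightarrow> D i (skew_tau \<odot>\<^bsub>M\<^esub> m) = skew_tau \<odot>\<^bsub>P\<^esub> D i m"
    and D_smult: "\<lbrakk>i \<le> k; m \<in> carrier M\<rbrakk> \<Longrightarrow>
      [:a:] \<odot>\<^bsub>P\<^esub> D i m = finsum P (\<lambda>l. D l ([:D_coeff l i a:] \<odot>\<^bsub>M\<^esub> m)) {..k}"
    and D_leibniz: "\<lbrakk>i \<le> k; m \<in> carrier M\<rbrakk> \<Longrightarrow>
      D i ([:a:] \<odot>\<^bsub>M\<^esub> m) = finsum P (\<lambda>j. [:hyperderiv j a:] \<odot>\<^bsub>P\<^esub> D (i - j) m) {..i}"
    and \<psi>_closed: "x \<in> carrier P \<Longrightarrow> \<psi> l x \<in> carrier M"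
    and \<psi>_add: "\<lbrakk>x \<in> carrier P; y \<in> carrier P\<rbrakk> \<Longrightarrow> \<psi> l (x \<oplus>\<^bsub>P\<^esub> y) = \<psi> l x \<oplus>\<^bsub>M\<^esub> \<psi> l y"
    and \<psi>_D: "\<lbrakk>i \<le> k; m \<in> carrier M\<rbrakk> \<Longrightarrow> \<psi> l (D i m) = (if l = i then m else \<zero>\<^bsub>M\<^esub>)"
    and decomposition: "x \<in> carrier P \<Longrightarrow> x = finsum P (\<lambda>l. D l (\<psi> l x)) {..k}"
begin

lemma M_smult_closed: "m \<in> carrier M \<Longrightarrow> Q \<odot>\<^bsub>M\<^esub> m \<in> carrier M"
  by (simp add: M.smult_closed skew_poly_ring_simps)

lemma P_smult_closed: "x \<in> carrier P \<Longrightarrow> Q \<odot>\<^bsub>P\<^esub> x \<in> carrier P"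
  by (simp add: P.smult_closed skew_poly_ring_simps)

lemma P_smult_distrib:
  "\<lbrakk>x \<in> carrier P; y \<in> carrier P\<rbrakk> \<Longrightarrow> Q \<odot>\<^bsub>P\<^esub> (x \<oplus>\<^bsub>P\<^esub> y) = Q \<odot>\<^bsub>P\<^esub> x \<oplus>\<^bsub>P\<^esub> Q \<odot>\<^bsub>P\<^esub> y"
  by (simp add: P.smult_r_distr skew_poly_ring_simps)

lemma M_smult_distrib:
  "\<lbrakk>x \<in> carrier M; y \<in> carrier M\<rbrakk> \<Longrightarrow> Q \<odot>\<^bsub>M\<^esub> (x \<oplus>\<^bsub>M\<^esub> y) = Q \<odot>\<^bsub>M\<^esub> x \<oplus>\<^bsub>M\<^esub> Q \<odot>\<^bsub>M\<^esub> y"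
  by (simp add: M.smult_r_distr skew_poly_ring_simps)

lemma M_smult_zero: "Q \<odot>\<^bsub>M\<^esub> \<zero>\<^bsub>M\<^esub> = \<zero>\<^bsub>M\<^esub>"
  by (simp add: M.smult_zero skew_poly_ring_simps)

lemma M_zero_smult: "m \<in> carrier M \<Longrightarrow> 0 \<odot>\<^bsub>M\<^esub> m = \<zero>\<^bsub>M\<^esub>"
  using M.zero_smult by (simp add: skew_poly_ring_simps)

lemma D_zero: "i \<le> k \<Longrightarrow> D i \<zero>\<^bsub>M\<^esub> = \<zero>\<^bsub>P\<^esub>"
  using finsum_additive_map[OF M.M.abelian_group_axioms P.M.abelian_group_axioms, of "D i" "\<lambda>_. \<zero>\<^bsub>M\<^esub>" "{}"]
  by (simp add: D_closed D_add)

lemma \<psi>_zero: "\<psi> l \<zero>\<^bsub>P\<^esub> = \<zero>\<^bsub>M\<^esub>"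
  using finsum_additive_map[OF P.M.abelian_group_axioms M.M.abelian_group_axioms, of "\<psi> l" "\<lambda>_. \<zero>\<^bsub>P\<^esub>" "{}"]
  by (simp add: \<psi>_closed \<psi>_add)

lemma additive_induct [consumes 1, case_names zero add D]:
  assumes "x \<in> carrier P"
    and "Q \<zero>\<^bsub>P\<^esub>" "\<And>x y. \<lbrakk>x \<in> carrier P; y \<in> carrier P; Q x; Q y\<rbrakk> \<Longrightarrow> Q (x \<oplus>\<^bsub>P\<^esub> y)"
    and "\<And>i m. \<lbrakk>i \<le> k; m \<in> carrier M\<rbrakk> \<Longrightarrow> Q (D i m)"
  shows "Q x"
proof -
  have "finsum P (\<lambda>l. D l (\<psi> l x)) {..k} \<in> {x \<in> carrier P. Q x}"
    using assms by (intro P.M.finsum_in_closed) (auto simp: D_closed \<psi>_closed)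
  then show ?thesis using decomposition[OF assms(1)] by simp
qed

lemma D_const:
  assumes "i \<le> k" "m \<in> carrier M"
  shows "D i ([:[:c:]:] \<odot>\<^bsub>M\<^esub> m) = [:[:c:]:] \<odot>\<^bsub>P\<^esub> D i m"
proof -
  have "[:[:c:]:] \<odot>\<^bsub>P\<^esub> D i m =
      finsum P (\<lambda>l. if i = l then D l ([:[:c:]:] \<odot>\<^bsub>M\<^esub> m) else \<zero>\<^bsub>P\<^esub>) {..k}"
    unfolding D_smult[OF assms] using assms
    by (intro P.M.finsum_cong')
      (auto simp: D_coeff_const M_zero_smult D_zero D_closed M_smult_closed)
  also have "\<dots> = D i ([:[:c:]:] \<odot>\<^bsub>M\<^esub> m)"
    using assms by (intro P.M.finsum_singleton) (auto simp: D_closed M_smult_closed)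
  finally show ?thesis ..
qed

lemma D_const_skew_linear:
  assumes "i \<le> k" "m \<in> carrier M" "Q \<in> carrier (const_skew_subring q)"
  shows "D i (Q \<odot>\<^bsub>M\<^esub> m) = Q \<odot>\<^bsub>P\<^esub> D i m"
  by (rule const_skew_linear[OF M.left_module_axioms P.left_module_axioms, where h = "D i"])
    (use assms in \<open>auto simp: D_closed D_add D_tau D_const simp del: One_nat_def\<close>)

lemma \<psi>_const_skew_linear:
  assumes "x \<in> carrier P" "Q \<in> carrier (const_skew_subring q)"
  shows "\<psi> l (Q \<odot>\<^bsub>P\<^esub> x) = Q \<odot>\<^bsub>M\<^esub> \<psi> l x"
  using assms(1)
proof (induction x rule: additive_induct)
  case zero
  show ?case
    using P.smult_zero[of Q] by (simp add: \<psi>_zero M_smult_zero skew_poly_ring_simps)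
next
  case (D i m)
  have "\<psi> l (Q \<odot>\<^bsub>P\<^esub> D i m) = \<psi> l (D i (Q \<odot>\<^bsub>M\<^esub> m))"
    using D assms(2) by (simp only: D_const_skew_linear)
  with D show ?case
    by (simp add: \<psi>_D M_smult_closed M_smult_zero)
qed (simp add: P_smult_distrib M_smult_distrib \<psi>_add \<psi>_closed P_smult_closed)

lemma const_left_modules:
  "left_module (const_skew_subring q) M" "left_module (const_skew_subring q) P"
  by (rule left_module_const_skew_subring, rule M.left_module_axioms)
    (rule left_module_const_skew_subring, rule P.left_module_axioms)

lemma poly_left_modules:
  "left_module (poly_subring q) M" "left_module (poly_subring q) P"
  by (rule left_module_poly_subring, rule M.left_module_axioms)
    (rule left_module_poly_subring, rule P.left_module_axioms)

definition symbols_over :: "'m set \<Rightarrow> 'p set" where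
  "symbols_over B = (\<Union>i\<le>k. D i ` B)"

lemma symbols_over_subset: "B \<subseteq> carrier M \<Longrightarrow> symbols_over B \<subseteq> carrier P"
  by (auto simp: symbols_over_def D_closed subset_iff)

lemma finite_symbols_over: "finite B \<Longrightarrow> finite (symbols_over B)"
  by (simp add: symbols_over_def)

lemma carrier_subset_if_D:
  assumes "W \<subseteq> carrier P" "\<zero>\<^bsub>P\<^esub> \<in> W" "\<And>x y. \<lbrakk>x \<in> W; y \<in> W\<rbrakk> \<Longrightarrow> x \<oplus>\<^bsub>P\<^esub> y \<in> W"
    and "\<And>i m. \<lbrakk>i \<le> k; m \<in> carrier M\<rbrakk> \<Longrightarrow> D i m \<in> W"
  shows "carrier P \<subseteq> W"
proof
  fix x assume "x \<in> carrier P"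
  then show "x \<in> W" by (induction x rule: additive_induct) (auto intro: assms)
qed

text \<open>By linearity of the \<open>D\<^sub>i\<close>, the \<open>m\<close> for which \<open>D\<^sub>i m\<close> lies in the span form a submodule containing \<open>B\<close>.\<close>

lemma const_span_symbols_over:
  assumes B: "B \<subseteq> carrier M" "left_span (const_skew_subring q) M B = carrier M"
  shows "left_span (const_skew_subring q) P (symbols_over B) = carrier P"
proof -
  let ?R = "const_skew_subring q :: 'k poly poly ring"
  interpret CM: left_module ?R M by (rule const_left_modules)
  interpret CP: left_module ?R P by (rule const_left_modules)
  note sub = symbols_over_subset[OF B(1)]
  let ?W = "left_span ?R P (symbols_over B)"
  have "carrier P \<subseteq> ?W"
  proof (rule carrier_subset_if_D)
    fix i m assume im: "i \<le> k" "m \<in> carrier M"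
    have "left_span ?R M B \<subseteq> {m \<in> carrier M. D i m \<in> ?W}"
    proof (rule CM.left_span_least)
      show "B \<subseteq> {m \<in> carrier M. D i m \<in> ?W}"
        using B(1) im(1) CP.left_span_base[OF sub] by (auto simp: symbols_over_def)
    qed (use im(1) in \<open>auto simp: D_zero D_add D_const_skew_linear M_smult_closed
        CP.left_span_zero CP.left_span_add[OF sub] CP.left_span_smult[OF sub]\<close>)
    then show "D i m \<in> ?W" using im B(2) by auto
  qed (auto simp: CP.left_span_zero CP.left_span_add[OF sub] CP.left_span_subset_carrier[OF sub, THEN subsetD])
  then show ?thesis using CP.left_span_subset_carrier[OF sub] by auto
qed

text \<open>The coefficient of \<open>D\<^sub>l b\<close> in a relation is isolated by applying the projection \<open>\<psi>\<^sub>l\<close>, which turns it into a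
  relation between elements of \<open>B\<close>.\<close>

lemma const_independent_symbols_over:
  assumes B: "B \<subseteq> carrier M" "left_independent (const_skew_subring q) M B"
  shows "left_independent (const_skew_subring q) P (symbols_over B)"
  unfolding left_independent_def
proof (intro allI impI ballI)
  let ?R = "const_skew_subring q :: 'k poly poly ring"
  fix A c x
  assume A: "finite A" "A \<subseteq> symbols_over B" and c: "c \<in> A \<rightarrow> carrier ?R"
    and sum: "finsum P (\<lambda>b. c b \<odot>\<^bsub>P\<^esub> b) A = \<zero>\<^bsub>P\<^esub>" and x: "x \<in> A"
  from x A obtain l b where l: "l \<le> k" and b: "b \<in> B" and xb: "x = D l b"
    by (auto simp: symbols_over_def)
  define A' where "A' = {b \<in> B. D l b \<in> A}"
  have AP: "A \<subseteq> carrier P" using A symbols_over_subset[OF B(1)] by auto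
  have A'_M: "A' \<subseteq> carrier M" using B(1) by (auto simp: A'_def)
  have inj: "inj_on (D l) A'"
    using A'_M l by (intro inj_on_inverseI[of _ "\<psi> l"]) (auto simp: \<psi>_D)
  have finA': "finite A'"
    using finite_imageD[OF finite_subset[OF _ A(1)] inj] by (auto simp: A'_def)
  have "\<zero>\<^bsub>M\<^esub> = \<psi> l (finsum P (\<lambda>b. c b \<odot>\<^bsub>P\<^esub> b) A)"
    by (simp add: sum \<psi>_zero)
  also have "\<dots> = finsum M (\<lambda>b. \<psi> l (c b \<odot>\<^bsub>P\<^esub> b)) A"
    using AP by (intro finsum_additive_map P.M.abelian_group_axioms M.M.abelian_group_axioms)
      (auto simp: \<psi>_closed \<psi>_add P_smult_closed)
  also have "\<dots> = finsum M (\<lambda>b. c b \<odot>\<^bsub>M\<^esub> \<psi> l b) A"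
    using AP c by (intro M.M.finsum_cong')
      (auto simp: \<psi>_const_skew_linear \<psi>_closed M_smult_closed Pi_iff)
  also have "\<dots> = finsum M (\<lambda>b. c b \<odot>\<^bsub>M\<^esub> \<psi> l b) (D l ` A')"
  proof (rule M.M.add.finprod_mono_neutral_cong_right[OF A(1)])
    fix b assume "b \<in> A - D l ` A'"
    with A obtain i b' where "i \<le> k" "b' \<in> B" "b = D i b'" "i \<noteq> l"
      by (fastforce simp: symbols_over_def A'_def)
    then show "c b \<odot>\<^bsub>M\<^esub> \<psi> l b = \<zero>\<^bsub>M\<^esub>"
      using B(1) by (auto simp: \<psi>_D M_smult_zero)
  qed (use AP in \<open>auto simp: A'_def \<psi>_closed M_smult_closed\<close>)
  also have "\<dots> = finsum M (\<lambda>b. c (D l b) \<odot>\<^bsub>M\<^esub> \<psi> l (D l b)) A'"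
    using A'_M l inj by (intro M.M.finsum_reindex) (auto simp: \<psi>_closed D_closed M_smult_closed)
  also have "\<dots> = finsum M (\<lambda>b. c (D l b) \<odot>\<^bsub>M\<^esub> b) A'"
    using A'_M l by (intro M.M.finsum_cong') (auto simp: \<psi>_D M_smult_closed)
  finally have zero: "finsum M (\<lambda>b. c (D l b) \<odot>\<^bsub>M\<^esub> b) A' = \<zero>\<^bsub>M\<^esub>" ..
  have "\<forall>b\<in>A'. c (D l b) = \<zero>\<^bsub>?R\<^esub>"
  proof (rule B(2)[unfolded left_independent_def, rule_format, OF finA' _ _ zero, THEN ballI])
  qed (use c in \<open>auto simp: A'_def Pi_iff\<close>)
  with x b xb show "c x = \<zero>\<^bsub>?R\<^esub>" by (auto simp: A'_def)
qed

text \<open>The maps \<open>D\<^sub>i\<close> are not \<open>K[t]\<close>-linear, but the Leibniz rule only involves \<open>D\<^sub>r m\<close> with \<open>r \<le> i\<close>.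
  So the set of those \<open>m\<close> for which all \<open>D\<^sub>r m\<close> with \<open>r \<le> k\<close> lie in the span is a \<open>K[t]\<close>-submodule.\<close>

lemma D_poly_span:
  assumes G: "G \<subseteq> carrier P" and B: "B \<subseteq> carrier M"
    and base: "\<And>i b. \<lbrakk>i \<le> k; b \<in> B\<rbrakk> \<Longrightarrow> D i b \<in> left_span (poly_subring q) P G"
    and im: "i \<le> k" and m: "m \<in> left_span (poly_subring q) M B"
  shows "D i m \<in> left_span (poly_subring q) P G"
proof -
  let ?R = "poly_subring q :: 'k poly poly ring"
  interpret CM: left_module ?R M by (rule poly_left_modules)
  interpret CP: left_module ?R P by (rule poly_left_modules)
  let ?W = "left_span ?R P G"
  have "left_span ?R M B \<subseteq> {m \<in> carrier M. \<forall>i\<le>k. D i m \<in> ?W}"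
  proof (rule CM.left_span_least)
    fix a m assume a: "a \<in> carrier ?R" and m: "m \<in> {m \<in> carrier M. \<forall>i\<le>k. D i m \<in> ?W}"
    from a obtain p where p: "a = [:p:]" by (auto simp: carrier_poly_subring)
    have "D i (a \<odot>\<^bsub>M\<^esub> m) \<in> ?W" if "i \<le> k" for i
      unfolding p using m that
      by (auto simp: D_leibniz carrier_poly_subring
          intro!: CP.left_span_finsum[OF G] CP.left_span_smult[OF G])
    then show "a \<odot>\<^bsub>M\<^esub> m \<in> {m \<in> carrier M. \<forall>i\<le>k. D i m \<in> ?W}"
      using m by (auto simp: M_smult_closed)
  qed (use B base in \<open>auto simp: D_zero D_add CP.left_span_zero CP.left_span_add[OF G]\<close>)
  with m im show ?thesis by auto
qed

lemma poly_span_symbols_over: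
  assumes B: "B \<subseteq> carrier M" "left_span (poly_subring q) M B = carrier M"
  shows "left_span (poly_subring q) P (symbols_over B) = carrier P"
proof -
  interpret CP: left_module "poly_subring q" P by (rule poly_left_modules)
  note sub = symbols_over_subset[OF B(1)]
  have base: "D i b \<in> left_span (poly_subring q) P (symbols_over B)" if "i \<le> k" "b \<in> B" for i b
    using that by (intro CP.left_span_base[OF sub]) (auto simp: symbols_over_def)
  have "carrier P \<subseteq> left_span (poly_subring q) P (symbols_over B)"
    using D_poly_span[OF sub B(1) base]
    by (intro carrier_subset_if_D) (auto simp: B(2) CP.left_span_zero CP.left_span_add[OF sub]
        CP.left_span_subset_carrier[OF sub, THEN subsetD])
  then show ?thesis using CP.left_span_subset_carrier[OF sub] by auto
qed

text \<open>Pulling the scalar \<open>(t + c)\<^bsup>l+k\<^esup>\<close> through \<open>D\<^sub>i\<close> subjects it to hyperdifferentiations of order at most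
  \<open>i \<le> k\<close>, which leave at least \<open>l\<close> of the factors \<open>t + c\<close>; these carry \<open>M\<close> into \<open>K[t] \<cdot> \<tau>(M)\<close>.\<close>

lemma linear_power_smult_in_tau_span:
  assumes l: "\<And>m. m \<in> carrier M \<Longrightarrow> [:[:c, 1:] ^ l:] \<odot>\<^bsub>M\<^esub> m
      \<in> left_span (poly_subring q) M ((\<lambda>m'. skew_tau \<odot>\<^bsub>M\<^esub> m') ` carrier M)"
    and x: "x \<in> carrier P"
  shows "[:[:c, 1:] ^ (l + k):] \<odot>\<^bsub>P\<^esub> x
      \<in> left_span (poly_subring q) P ((\<lambda>x'. skew_tau \<odot>\<^bsub>P\<^esub> x') ` carrier P)"
    (is "_ \<in> ?W")
proof -
  let ?R = "poly_subring q :: 'k poly poly ring"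
  interpret CM: left_module ?R M by (rule poly_left_modules)
  interpret CP: left_module ?R P by (rule poly_left_modules)
  let ?X = "(\<lambda>x'. skew_tau \<odot>\<^bsub>P\<^esub> x') ` carrier P"
  let ?Y = "(\<lambda>m'. skew_tau \<odot>\<^bsub>M\<^esub> m') ` carrier M"
  have X: "?X \<subseteq> carrier P" and Y: "?Y \<subseteq> carrier M"
    by (auto simp: P_smult_closed M_smult_closed)
  have base: "D i b \<in> ?W" if "i \<le> k" "b \<in> ?Y" for i b
    using that by (auto simp: D_tau D_closed simp del: One_nat_def intro!: CP.left_span_base[OF X])
  show ?thesis
    using x
  proof (induction x rule: additive_induct)
    case zero
    then show ?case using P.smult_zero by (simp add: CP.left_span_zero skew_poly_ring_simps)
  next
    case (add x y)
    then show ?case by (simp add: P_smult_distrib CP.left_span_add[OF X] del: One_nat_def)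
  next
    case (D i m)
    have "D r ([:D_coeff r i ([:c, 1:] ^ (l + k)):] \<odot>\<^bsub>M\<^esub> m) \<in> ?W" if "r \<le> k" for r
    proof (rule D_poly_span[OF X Y base that])
      obtain b where "D_coeff r i ([:c, 1:] ^ (l + k)) = b * [:c, 1:] ^ l"
        using linear_power_dvd_D_coeff[OF D(1), of c l r] by (auto simp: dvd_def mult.commute)
      then have "[:D_coeff r i ([:c, 1:] ^ (l + k)):] \<odot>\<^bsub>M\<^esub> m = [:b:] \<odot>\<^bsub>M\<^esub> ([:[:c, 1:] ^ l:] \<odot>\<^bsub>M\<^esub> m)"
        using D(2) M.smult_assoc[of "[:b:]" "[:[:c, 1:] ^ l:]" m]
        by (simp add: skew_poly_ring_simps skew_mult_const)
      then show "[:D_coeff r i ([:c, 1:] ^ (l + k)):] \<odot>\<^bsub>M\<^esub> m \<in> left_span ?R M ?Y"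
        using CM.left_span_smult[OF Y _ l[OF D(2)], of "[:b:]"] by (simp add: carrier_poly_subring)
    qed
    then show ?case
      unfolding D_smult[OF D] by (intro CP.left_span_finsum[OF X]) auto
  qed
qed

theorem t_motive_frame:
  assumes "t_motive q \<theta> M"
  shows "t_motive q \<theta> P"
proof -
  let ?R = "const_skew_subring q :: 'k poly poly ring"
  from assms obtain B G l where
    B: "B \<subseteq> carrier M" "left_independent ?R M B" "left_span ?R M B = carrier M" and
    G: "G \<subseteq> carrier M" "finite G" "left_span ?R M G = carrier M" and
    l: "\<forall>m\<in>carrier M. [:[:- \<theta>, 1:] ^ l:] \<odot>\<^bsub>M\<^esub> m
        \<in> left_span (poly_subring q) M ((\<lambda>m'. skew_tau \<odot>\<^bsub>M\<^esub> m') ` carrier M)"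
    unfolding t_motive_def free_left_module_def fin_gen_left_module_def by blast
  have "free_left_module ?R P"
    unfolding free_left_module_def
    using B by (intro exI[of _ "symbols_over B"] conjI symbols_over_subset
        const_independent_symbols_over const_span_symbols_over)
  moreover have "fin_gen_left_module ?R P"
    unfolding fin_gen_left_module_def
    using G by (intro exI[of _ "symbols_over G"] conjI symbols_over_subset
        finite_symbols_over const_span_symbols_over)
  moreover have "\<forall>x\<in>carrier P. [:[:- \<theta>, 1:] ^ (l + k):] \<odot>\<^bsub>P\<^esub> x
        \<in> left_span (poly_subring q) P ((\<lambda>x'. skew_tau \<odot>\<^bsub>P\<^esub> x') ` carrier P)"
    using l by (intro ballI linear_power_smult_in_tau_span) blast+
  ultimately show ?thesis
    unfolding t_motive_def using P.left_module_axioms by (intro conjI exI[of _ "l + k"])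
qed

theorem abelian_t_motive_frame:
  assumes "abelian_t_motive q \<theta> M"
  shows "abelian_t_motive q \<theta> P"
proof -
  from assms obtain G where
    "G \<subseteq> carrier M" "finite G" "left_span (poly_subring q) M G = carrier M"
    unfolding abelian_t_motive_def fin_gen_left_module_def by blast
  then have "fin_gen_left_module (poly_subring q) P"
    unfolding fin_gen_left_module_def
    by (intro exI[of _ "symbols_over G"] conjI symbols_over_subset
        finite_symbols_over poly_span_symbols_over) simp_all
  with assms t_motive_frame[of \<theta>] show ?thesis
    unfolding abelian_t_motive_def by blast
qed

end

section \<open>The module over the skew polynomial ring given by a semilinear map\<close>

locale semilinear = skew_ring q field_type + N: left_module "ring_of_type_algebra :: 'k poly ring" N
  for q and field_type :: "'k::field itself" and N :: "('k poly, 'n) module" +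
  fixes T :: "'n \<Rightarrow> 'n"
  assumes T_closed: "x \<in> carrier N \<Longrightarrow> T x \<in> carrier N"
    and T_add: "\<lbrakk>x \<in> carrier N; y \<in> carrier N\<rbrakk> \<Longrightarrow> T (x \<oplus>\<^bsub>N\<^esub> y) = T x \<oplus>\<^bsub>N\<^esub> T y"
    and T_smult: "x \<in> carrier N \<Longrightarrow> T (a \<odot>\<^bsub>N\<^esub> x) = twist q a \<odot>\<^bsub>N\<^esub> T x"
begin

abbreviation act :: "'k poly poly \<Rightarrow> 'n \<Rightarrow> 'n" where
  "act P x \<equiv> P \<odot>\<^bsub>skew_module N T\<^esub> x"

lemma smult_closed: "x \<in> carrier N \<Longrightarrow> a \<odot>\<^bsub>N\<^esub> x \<in> carrier N"
  by (simp add: N.smult_closed type_ring_simps)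

lemma zero_smult: "x \<in> carrier N \<Longrightarrow> 0 \<odot>\<^bsub>N\<^esub> x = \<zero>\<^bsub>N\<^esub>"
  using N.zero_smult by (simp add: type_ring_simps)

lemma smult_l_distr:
  "x \<in> carrier N \<Longrightarrow> (a + b) \<odot>\<^bsub>N\<^esub> x = a \<odot>\<^bsub>N\<^esub> x \<oplus>\<^bsub>N\<^esub> b \<odot>\<^bsub>N\<^esub> x"
  using N.smult_l_distr[of a b x] by (simp add: type_ring_simps)

lemma smult_assoc: "x \<in> carrier N \<Longrightarrow> (a * b) \<odot>\<^bsub>N\<^esub> x = a \<odot>\<^bsub>N\<^esub> (b \<odot>\<^bsub>N\<^esub> x)"
  using N.smult_assoc[of a b x] by (simp add: type_ring_simps)

lemma T_pow_closed: "x \<in> carrier N \<Longrightarrow> (T ^^ i) x \<in> carrier N"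
  by (induction i) (simp_all add: T_closed)

lemma T_pow_add:
  "\<lbrakk>x \<in> carrier N; y \<in> carrier N\<rbrakk> \<Longrightarrow> (T ^^ i) (x \<oplus>\<^bsub>N\<^esub> y) = (T ^^ i) x \<oplus>\<^bsub>N\<^esub> (T ^^ i) y"
  by (induction i) (simp_all add: T_add T_pow_closed)

lemma T_pow_smult:
  "x \<in> carrier N \<Longrightarrow> (T ^^ i) (a \<odot>\<^bsub>N\<^esub> x) = (twist q ^^ i) a \<odot>\<^bsub>N\<^esub> (T ^^ i) x"
  by (induction i) (simp_all add: T_smult T_pow_closed smult_closed)

lemma T_pow_finsum:
  "f \<in> A \<rightarrow> carrier N \<Longrightarrow> (T ^^ i) (finsum N f A) = finsum N (\<lambda>j. (T ^^ i) (f j)) A"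
  by (rule finsum_additive_map)
    (auto simp: N.M.abelian_group_axioms T_pow_closed T_pow_add)

lemma act_eq:
  assumes "x \<in> carrier N" "Polynomial.degree P \<le> n"
  shows "act P x = finsum N (\<lambda>i. Polynomial.coeff P i \<odot>\<^bsub>N\<^esub> (T ^^ i) x) {..n}"
  unfolding skew_module_def module.simps using assms
  by (intro N.M.add.finprod_mono_neutral_cong_left)
    (auto simp: coeff_eq_0 zero_smult T_pow_closed smult_closed)

lemma act_closed: "x \<in> carrier N \<Longrightarrow> act P x \<in> carrier N"
  by (auto simp: act_eq[OF _ order.refl] smult_closed T_pow_closed intro!: N.M.finsum_closed)

lemma act_add:
  assumes "x \<in> carrier N"
  shows "act (P + Q) x = act P x \<oplus>\<^bsub>N\<^esub> act Q x"
proof -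
  define n where "n = max (Polynomial.degree P) (Polynomial.degree Q)"
  have "Polynomial.degree (P + Q) \<le> n" "Polynomial.degree P \<le> n" "Polynomial.degree Q \<le> n"
    by (auto simp: n_def degree_add_le_max)
  with assms show ?thesis
    by (simp add: act_eq smult_l_distr T_pow_closed smult_closed N.M.finsum_addf Pi_iff)
qed

lemma act_sum:
  assumes "x \<in> carrier N"
  shows "act (sum f A) x = finsum N (\<lambda>i. act (f i) x) A"
proof (induction A rule: infinite_finite_induct)
  case (insert i F)
  then show ?case by (simp add: act_add assms act_closed Pi_iff)
qed (simp_all add: assms act_eq[of x 0 0] zero_smult)

lemma act_monom:
  assumes "x \<in> carrier N"
  shows "act (Polynomial.monom a n) x = a \<odot>\<^bsub>N\<^esub> (T ^^ n) x"
proof -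
  have "act (Polynomial.monom a n) x =
      finsum N (\<lambda>i. if n = i then a \<odot>\<^bsub>N\<^esub> (T ^^ i) x else \<zero>\<^bsub>N\<^esub>) {..n}"
    using assms by (subst act_eq[of _ _ n])
      (auto simp: degree_monom_le zero_smult T_pow_closed smult_closed intro!: N.M.finsum_cong')
  also have "\<dots> = a \<odot>\<^bsub>N\<^esub> (T ^^ n) x"
    using assms by (intro N.M.finsum_singleton) (auto simp: T_pow_closed smult_closed)
  finally show ?thesis .
qed

lemma act_const: "x \<in> carrier N \<Longrightarrow> act [:a:] x = a \<odot>\<^bsub>N\<^esub> x"
  using act_monom[of x a 0] by (simp add: Polynomial.monom_0)

lemma act_tau: "x \<in> carrier N \<Longrightarrow> act skew_tau x = T x"
  using N.smult_one[of "T x"] by (simp add: act_monom type_ring_simps T_closed)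

lemma act_distrib:
  assumes "x \<in> carrier N" "y \<in> carrier N"
  shows "act P (x \<oplus>\<^bsub>N\<^esub> y) = act P x \<oplus>\<^bsub>N\<^esub> act P y"
  using assms N.smult_r_distr
  by (simp add: act_eq[OF _ order.refl] T_pow_add T_pow_closed smult_closed Pi_iff type_ring_simps)

text \<open>Both sides are double sums over the monomials of \<open>P\<close> and \<open>Q\<close>; they agree term by term because moving
  \<open>T\<^sup>i\<close> past a scalar twists it \<open>i\<close> times, as moving \<open>\<tau>\<^sup>i\<close> does in the skew polynomial ring.\<close>

lemma act_mult:
  assumes x: "x \<in> carrier N"
  shows "act (P \<otimes>\<^bsub>S\<^esub> Q) x = act P (act Q x)"
proof -
  let ?c = "Polynomial.coeff P" and ?d = "Polynomial.coeff Q"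
  have "act (P \<otimes>\<^bsub>S\<^esub> Q) x = finsum N (\<lambda>i. finsum N (\<lambda>j.
      (?c i * (twist q ^^ i) (?d j)) \<odot>\<^bsub>N\<^esub> (T ^^ (i + j)) x) {..Polynomial.degree Q}) {..Polynomial.degree P}"
    using x by (simp add: skew_mult_eq act_sum act_monom)
  also have "\<dots> = finsum N (\<lambda>i. ?c i \<odot>\<^bsub>N\<^esub> (T ^^ i) (act Q x)) {..Polynomial.degree P}"
  proof (rule N.M.finsum_cong'[OF refl])
    show "(\<lambda>i. ?c i \<odot>\<^bsub>N\<^esub> (T ^^ i) (act Q x)) \<in> {..Polynomial.degree P} \<rightarrow> carrier N"
      using x by (simp add: act_closed T_pow_closed smult_closed)
    fix i
    have "?c i \<odot>\<^bsub>N\<^esub> (T ^^ i) (act Q x) = ?c i \<odot>\<^bsub>N\<^esub> finsum N (\<lambda>j.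
        (twist q ^^ i) (?d j) \<odot>\<^bsub>N\<^esub> (T ^^ (i + j)) x) {..Polynomial.degree Q}"
      using x by (simp add: act_eq[OF _ order.refl] T_pow_finsum T_pow_smult T_pow_closed
          smult_closed Pi_iff funpow_add)
    also have "\<dots> = finsum N (\<lambda>j.
        (?c i * (twist q ^^ i) (?d j)) \<odot>\<^bsub>N\<^esub> (T ^^ (i + j)) x) {..Polynomial.degree Q}"
      using x by (subst N.finsum_smult)
        (auto simp: type_ring_simps smult_assoc T_pow_closed smult_closed)
    finally show "finsum N (\<lambda>j. (?c i * (twist q ^^ i) (?d j)) \<odot>\<^bsub>N\<^esub> (T ^^ (i + j)) x)
        {..Polynomial.degree Q} = ?c i \<odot>\<^bsub>N\<^esub> (T ^^ i) (act Q x)" by simp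
  qed
  also have "\<dots> = act P (act Q x)"
    using x by (simp add: act_eq[of "act Q x", OF _ order.refl] act_closed)
  finally show ?thesis .
qed

lemma skew_module_simps:
  "carrier (skew_module N T) = carrier N" "\<zero>\<^bsub>skew_module N T\<^esub> = \<zero>\<^bsub>N\<^esub>"
  "x \<oplus>\<^bsub>skew_module N T\<^esub> y = x \<oplus>\<^bsub>N\<^esub> y"
  by (simp_all add: skew_module_def)

lemma skew_module_left_module: "left_module S (skew_module N T)"
proof -
  have "abelian_group (skew_module N T)"
  proof (rule abelian_groupI)
    fix x assume "x \<in> carrier (skew_module N T)"
    then show "\<exists>y\<in>carrier (skew_module N T). y \<oplus>\<^bsub>skew_module N T\<^esub> x = \<zero>\<^bsub>skew_module N T\<^esub>"
      by (intro bexI[of _ "\<ominus>\<^bsub>N\<^esub> x"]) (simp_all add: skew_module_simps N.M.l_neg)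
  qed (simp_all add: skew_module_simps N.M.a_ac)
  moreover have "act 1 x = x" if "x \<in> carrier N" for x
    using that N.smult_one[of x] act_const[of x 1, folded one_pCons] by (simp add: type_ring_simps)
  ultimately show ?thesis
    by (intro left_module.intro left_module_axioms.intro ring)
      (simp_all add: skew_poly_ring_simps skew_module_simps act_closed act_add act_distrib act_mult)
qed

end

section \<open>Free modules on a set of symbols\<close>

lemma free_module_on_simps:
  "carrier (free_module_on S) = {f. Poly_Mapping.keys f \<subseteq> S}" "\<zero>\<^bsub>free_module_on S\<^esub> = 0"
  "f \<oplus>\<^bsub>free_module_on S\<^esub> g = f + g"
  "a \<odot>\<^bsub>free_module_on S\<^esub> f = Poly_Mapping.map ((*) a) f"
  by (simp_all add: free_module_on_def)

lemma lookup_map_mult: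
  "Poly_Mapping.lookup (Poly_Mapping.map ((*) a) f) x = a * Poly_Mapping.lookup f x"
  for f :: "'s \<Rightarrow>\<^sub>0 'r::comm_ring_1"
  by (simp add: Poly_Mapping.map.rep_eq when_def)

lemma keys_subset_iff: "Poly_Mapping.keys f \<subseteq> S \<longleftrightarrow> (\<forall>x. x \<notin> S \<longrightarrow> Poly_Mapping.lookup f x = 0)"
  by (auto simp: Poly_Mapping.in_keys_iff)

lemma free_module_on_left_module:
  fixes S :: "'s set"
  shows "left_module (ring_of_type_algebra :: 'r::comm_ring_1 ring) (free_module_on S)"
proof (intro left_module.intro left_module_axioms.intro abelian_groupI ring_from_type_algebra)
  fix f :: "'s \<Rightarrow>\<^sub>0 'r" assume "f \<in> carrier (free_module_on S)"
  then show "\<exists>g\<in>carrier (free_module_on S). g \<oplus>\<^bsub>free_module_on S\<^esub> f = \<zero>\<^bsub>free_module_on S\<^esub>"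
    by (intro bexI[of _ "- f"]) (auto simp: free_module_on_simps keys_subset_iff)
qed (auto simp: free_module_on_simps keys_subset_iff type_ring_simps lookup_map_mult
    Poly_Mapping.lookup_add algebra_simps intro!: poly_mapping_eqI)

lemma free_module_on_induct [consumes 1, case_names zero single add]:
  assumes "Poly_Mapping.keys f \<subseteq> S"
    and "P 0"
    and "\<And>x a. x \<in> S \<Longrightarrow> P (Poly_Mapping.single x a)"
    and "\<And>f g. \<lbrakk>Poly_Mapping.keys f \<subseteq> S; Poly_Mapping.keys g \<subseteq> S; P f; P g\<rbrakk> \<Longrightarrow> P (f + g)"
  shows "P f"
  using assms(1)
proof (induction f rule: Poly_Mapping.update_induct)
  case (update f a b)
  have eq: "Poly_Mapping.update a b f = Poly_Mapping.single a b + f"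
    using update.hyps
    by (intro poly_mapping_eqI)
      (auto simp: Poly_Mapping.lookup_update Poly_Mapping.lookup_add Poly_Mapping.lookup_single
        Poly_Mapping.in_keys_iff when_def)
  have "insert a (Poly_Mapping.keys f) \<subseteq> S"
    using update.prems update.hyps by (simp add: Poly_Mapping.keys_update)
  then show ?case
    unfolding eq using update.hyps by (intro assms(3,4) update.IH) auto
qed (rule assms(2))

lemma finsum_free_module_on:
  assumes "f \<in> A \<rightarrow> carrier (free_module_on S)"
  shows "finsum (free_module_on S) f A = sum f (A :: 'i set)"
    and "sum f A \<in> carrier (free_module_on S :: ('r::comm_ring_1, _) module)"
proof -
  interpret left_module "ring_of_type_algebra :: 'r ring" "free_module_on S :: ('r, _) module"
    by (rule free_module_on_left_module)
  show eq: "finsum (free_module_on S) f A = sum f A"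
    using assms
  proof (induction A rule: infinite_finite_induct)
    case (insert x F)
    then show ?case by (subst M.finsum_insert) (auto simp: free_module_on_simps(3))
  qed (simp_all add: free_module_on_simps(2))
  show "sum f A \<in> carrier (free_module_on S :: ('r, _) module)"
    unfolding eq[symmetric] using assms by (rule M.finsum_closed)
qed

lemma single_sum: "Poly_Mapping.single x (sum f A) = (\<Sum>i\<in>A. Poly_Mapping.single x (f i))"
  by (induction A rule: infinite_finite_induct) (simp_all add: Poly_Mapping.single_add)

section \<open>Coordinates on the prolongation\<close>

locale prolongation_setup = skew_ring q field_type + M: left_module "skew_poly_ring q" M
  for q and field_type :: "'k::field itself" and M :: "('k poly poly, 'm) module" +
  fixes k :: nat
begin

abbreviation K_t :: "'k poly ring" where "K_t \<equiv> ring_of_type_algebra"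
abbreviation F :: "('k poly, (nat \<times> 'm) \<Rightarrow>\<^sub>0 'k poly) module" where
  "F \<equiv> free_module_on (symbols k M)"
abbreviation N :: "((nat \<times> 'm) \<Rightarrow>\<^sub>0 'k poly) set" where "N \<equiv> prolongation_submodule k M"

lemma smult_closed: "m \<in> carrier M \<Longrightarrow> P \<odot>\<^bsub>M\<^esub> m \<in> carrier M"
  by (simp add: M.smult_closed skew_poly_ring_simps)

lemma smult_distrib:
  "\<lbrakk>m \<in> carrier M; m' \<in> carrier M\<rbrakk> \<Longrightarrow> P \<odot>\<^bsub>M\<^esub> (m \<oplus>\<^bsub>M\<^esub> m') = P \<odot>\<^bsub>M\<^esub> m \<oplus>\<^bsub>M\<^esub> P \<odot>\<^bsub>M\<^esub> m'"
  by (simp add: M.smult_r_distr skew_poly_ring_simps)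

lemma smult_zero: "P \<odot>\<^bsub>M\<^esub> \<zero>\<^bsub>M\<^esub> = \<zero>\<^bsub>M\<^esub>"
  by (simp add: M.smult_zero skew_poly_ring_simps)

lemma zero_smult: "m \<in> carrier M \<Longrightarrow> 0 \<odot>\<^bsub>M\<^esub> m = \<zero>\<^bsub>M\<^esub>"
  using M.zero_smult by (simp add: skew_poly_ring_simps)

lemma one_smult: "m \<in> carrier M \<Longrightarrow> [:1:] \<odot>\<^bsub>M\<^esub> m = m"
  using M.smult_one[of m] by (simp only: skew_poly_ring_simps one_pCons)

lemma const_add:
  "m \<in> carrier M \<Longrightarrow> [:a + b:] \<odot>\<^bsub>M\<^esub> m = [:a:] \<odot>\<^bsub>M\<^esub> m \<oplus>\<^bsub>M\<^esub> [:b:] \<odot>\<^bsub>M\<^esub> m"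
  using M.smult_l_distr[of "[:a:]" "[:b:]" m] by (simp add: skew_poly_ring_simps)

lemma const_mult: "m \<in> carrier M \<Longrightarrow> [:a * b:] \<odot>\<^bsub>M\<^esub> m = [:a:] \<odot>\<^bsub>M\<^esub> ([:b:] \<odot>\<^bsub>M\<^esub> m)"
  using M.smult_assoc[of "[:a:]" "[:b:]" m] by (simp add: skew_poly_ring_simps skew_mult_const)

lemma const_sum:
  "m \<in> carrier M \<Longrightarrow> [:sum f A:] \<odot>\<^bsub>M\<^esub> m = finsum M (\<lambda>i. [:f i:] \<odot>\<^bsub>M\<^esub> m) A"
  by (induction A rule: infinite_finite_induct)
    (simp_all add: zero_smult const_add smult_closed)

lemma tau_const:
  "m \<in> carrier M \<Longrightarrow> skew_tau \<odot>\<^bsub>M\<^esub> ([:a:] \<odot>\<^bsub>M\<^esub> m) = [:twist q a:] \<odot>\<^bsub>M\<^esub> (skew_tau \<odot>\<^bsub>M\<^esub> m)"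
  using M.smult_assoc[of skew_tau "[:a:]" m] M.smult_assoc[of "[:twist q a:]" skew_tau m]
    skew_tau_commute[OF q_pos, of a]
  by (simp add: skew_poly_ring_simps del: One_nat_def)

lemma F_simps:
  "carrier F = {f. Poly_Mapping.keys f \<subseteq> symbols k M}" "\<zero>\<^bsub>F\<^esub> = 0" "f \<oplus>\<^bsub>F\<^esub> g = f + g"
  "a \<odot>\<^bsub>F\<^esub> f = Poly_Mapping.map ((*) a) f"
  by (rule free_module_on_simps)+

lemma F_left_module: "left_module K_t F"
  by (rule free_module_on_left_module)

sublocale F: left_module K_t F
  by (rule F_left_module)

lemma F_minus: "f \<in> carrier F \<Longrightarrow> \<ominus>\<^bsub>F\<^esub> f = - f"
  by (rule F.M.minus_equality) (simp_all add: F_simps)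

lemma F_diff: "\<lbrakk>f \<in> carrier F; g \<in> carrier F\<rbrakk> \<Longrightarrow> f \<ominus>\<^bsub>F\<^esub> g = f - g"
  by (simp add: a_minus_def F_minus F_simps(3))

lemma F_add_closed: "\<lbrakk>f \<in> carrier F; g \<in> carrier F\<rbrakk> \<Longrightarrow> f + g \<in> carrier F"
  using F.M.a_closed[of f g] by (simp add: F_simps(3))

lemma F_diff_closed: "\<lbrakk>f \<in> carrier F; g \<in> carrier F\<rbrakk> \<Longrightarrow> f - g \<in> carrier F"
  using F.M.minus_closed[of f g] by (simp add: F_diff)

lemma F_single: "\<lbrakk>i \<le> k; m \<in> carrier M\<rbrakk> \<Longrightarrow> Poly_Mapping.single (i, m) a \<in> carrier F"
  by (auto simp: free_module_on_simps symbols_def)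

lemma F_sum: "(\<And>i. i \<in> A \<Longrightarrow> f i \<in> carrier F) \<Longrightarrow> sum f A \<in> carrier F"
  by (intro finsum_free_module_on(2)) auto

lemma F_induct [consumes 1, case_names zero single add]:
  assumes "f \<in> carrier F"
    and "P 0"
    and "\<And>i m a. \<lbrakk>i \<le> k; m \<in> carrier M\<rbrakk> \<Longrightarrow> P (Poly_Mapping.single (i, m) a)"
    and "\<And>f g. \<lbrakk>f \<in> carrier F; g \<in> carrier F; P f; P g\<rbrakk> \<Longrightarrow> P (f + g)"
  shows "P f"
  using assms(1) unfolding F_simps mem_Collect_eq
  by (induction rule: free_module_on_induct) (auto simp: symbols_def free_module_on_simps intro: assms)

text \<open>The \<open>l\<close>-th coordinate of a combination of symbols: the element of \<open>M\<close> that ends up behind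
  \<open>D\<^sub>l\<close> when every \<open>a \<cdot> D\<^sub>i m\<close> is rewritten as a sum of symbols without scalars.\<close>

definition coord :: "nat \<Rightarrow> ((nat \<times> 'm) \<Rightarrow>\<^sub>0 'k poly) \<Rightarrow> 'm" where
  "coord l f = finsum M (\<lambda>(i, m). [:D_coeff l i (Poly_Mapping.lookup f (i, m)):] \<odot>\<^bsub>M\<^esub> m)
     (Poly_Mapping.keys f)"

lemma coord_eq:
  assumes "finite A" "Poly_Mapping.keys f \<subseteq> A" "A \<subseteq> symbols k M"
  shows "coord l f = finsum M (\<lambda>(i, m). [:D_coeff l i (Poly_Mapping.lookup f (i, m)):] \<odot>\<^bsub>M\<^esub> m) A"
  unfolding coord_def
  using assms by (intro M.M.add.finprod_mono_neutral_cong_left)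
    (auto simp: Poly_Mapping.in_keys_iff zero_smult smult_closed symbols_def subset_iff)

lemma coord_closed: "f \<in> carrier F \<Longrightarrow> coord l f \<in> carrier M"
  unfolding coord_def
  by (rule M.M.finsum_closed) (auto simp: free_module_on_simps symbols_def smult_closed)

lemma coord_zero [simp]: "coord l 0 = \<zero>\<^bsub>M\<^esub>"
  by (simp add: coord_def)

lemma coord_single:
  assumes "i \<le> k" "m \<in> carrier M"
  shows "coord l (Poly_Mapping.single (i, m) a) = [:D_coeff l i a:] \<odot>\<^bsub>M\<^esub> m"
  using assms by (subst coord_eq[of "{(i, m)}"]) (auto simp: symbols_def smult_closed)

lemma coord_add:
  assumes "f \<in> carrier F" "g \<in> carrier F"
  shows "coord l (f + g) = coord l f \<oplus>\<^bsub>M\<^esub> coord l g"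
proof -
  let ?A = "Poly_Mapping.keys f \<union> Poly_Mapping.keys g"
  have A: "finite ?A" "?A \<subseteq> symbols k M" using assms by (auto simp: F_simps)
  then have eq: "coord l h = finsum M (\<lambda>(i, m). [:D_coeff l i (Poly_Mapping.lookup h (i, m)):] \<odot>\<^bsub>M\<^esub> m) ?A"
    if "Poly_Mapping.keys h \<subseteq> ?A" for h
    using that by (intro coord_eq)
  have "coord l f \<oplus>\<^bsub>M\<^esub> coord l g = finsum M (\<lambda>p.
      (case p of (i, m) \<Rightarrow> [:D_coeff l i (Poly_Mapping.lookup f (i, m)):] \<odot>\<^bsub>M\<^esub> m) \<oplus>\<^bsub>M\<^esub>
      (case p of (i, m) \<Rightarrow> [:D_coeff l i (Poly_Mapping.lookup g (i, m)):] \<odot>\<^bsub>M\<^esub> m)) ?A"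
    using A(2) by (subst (1 2) eq) (auto intro!: M.M.finsum_addf[symmetric] simp: symbols_def smult_closed)
  also have "\<dots> = coord l (f + g)"
    using A(2) by (subst eq[OF Poly_Mapping.keys_add])
      (auto intro!: M.M.finsum_cong' simp: symbols_def smult_closed D_coeff_add const_add
        Poly_Mapping.lookup_add)
  finally show ?thesis by simp
qed

lemma coord_sum:
  assumes "f \<in> A \<rightarrow> carrier F"
  shows "coord l (sum f A) = finsum M (\<lambda>i. coord l (f i)) A"
  using finsum_additive_map[OF F.M.abelian_group_axioms M.M.abelian_group_axioms _ _ assms, of "coord l"]
  by (simp add: coord_closed F_simps(3) coord_add finsum_free_module_on(1)[OF assms])

lemma coord_diff_eq_zero:
  assumes "f \<in> carrier F" "g \<in> carrier F" "coord l f = coord l g"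
  shows "coord l (f - g) = \<zero>\<^bsub>M\<^esub>"
  using coord_add[OF F_diff_closed[OF assms(1,2)] assms(2), of l] assms(3)
    coord_closed[OF assms(2)] coord_closed[OF F_diff_closed[OF assms(1,2)]]
  by (metis diff_add_cancel M.M.add.r_cancel_one')

text \<open>Scalars do not act on the coordinates separately, but triangularly; in particular the common kernel
  of all coordinates is a \<open>K[t]\<close>-submodule.\<close>

lemma coord_smult:
  assumes "f \<in> carrier F"
  shows "coord l (Poly_Mapping.map ((*) a) f) = finsum M (\<lambda>j. [:D_coeff l j a:] \<odot>\<^bsub>M\<^esub> coord j f) {..k}"
  using assms
proof (induction f rule: F_induct)
  case zero
  have "Poly_Mapping.map ((*) a) 0 = (0 :: (nat \<times> 'm) \<Rightarrow>\<^sub>0 'k poly)"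
    by (rule poly_mapping_eqI) (simp add: lookup_map_mult)
  then show ?case by (simp add: smult_zero)
next
  case (single i m b)
  then show ?case
    by (simp add: coord_single D_coeff_mult const_sum const_mult)
next
  case (add f g)
  have "Poly_Mapping.map ((*) a) (f + g) = Poly_Mapping.map ((*) a) f + Poly_Mapping.map ((*) a) g"
    by (rule poly_mapping_eqI) (simp add: lookup_map_mult Poly_Mapping.lookup_add distrib_left)
  moreover have "Poly_Mapping.map ((*) a) h \<in> carrier F" if "h \<in> carrier F" for h
    using F.smult_closed[of a h] that by (simp add: type_ring_simps F_simps(4))
  ultimately show ?case
    using add by (simp add: coord_add smult_distrib coord_closed smult_closed Pi_iff)
qed

section \<open>The relations are the kernel of the coordinates\<close>

lemma relations_subset: "prolongation_relations k M \<subseteq> carrier F"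
proof
  fix r assume "r \<in> prolongation_relations k M"
  then consider
      (add) i m m' where "r = D_symbol i (m \<oplus>\<^bsub>M\<^esub> m') - (D_symbol i m + D_symbol i m')"
        "i \<le> k" "m \<in> carrier M" "m' \<in> carrier M"
    | (smult) i a m where "r = D_symbol i ([:a:] \<odot>\<^bsub>M\<^esub> m) -
        (\<Sum>j\<le>i. Poly_Mapping.single (i - j, m) (hyperderiv j a))" "i \<le> k" "m \<in> carrier M"
    unfolding prolongation_relations_def by blast
  then show "r \<in> carrier F"
    by cases (auto intro!: F_diff_closed F_add_closed F_sum F_single smult_closed)
qed

text \<open>For the Leibniz relations this is one half of the binomial inversion, \<open>D_coeff_hyperderiv_sum\<close>.\<close>

lemma coord_relations:
  assumes "r \<in> prolongation_relations k M"
  shows "coord l r = \<zero>\<^bsub>M\<^esub>"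
  using assms unfolding prolongation_relations_def
proof (elim UnE CollectE exE conjE)
  fix i m m' assume r: "r = D_symbol i (m \<oplus>\<^bsub>M\<^esub> m') - (D_symbol i m + D_symbol i m')"
    and "i \<le> k" "m \<in> carrier M" "m' \<in> carrier M"
  then show ?thesis
    unfolding r by (intro coord_diff_eq_zero)
      (auto intro!: F_add_closed F_single simp: coord_add F_single coord_single D_coeff_one smult_distrib)
next
  fix i a m assume r: "r = D_symbol i ([:a:] \<odot>\<^bsub>M\<^esub> m) -
      (\<Sum>j\<le>i. Poly_Mapping.single (i - j, m) (hyperderiv j a))" and im: "i \<le> k" "m \<in> carrier M"
  have "coord l (\<Sum>j\<le>i. Poly_Mapping.single (i - j, m) (hyperderiv j a)) =
      [:\<Sum>j\<le>i. D_coeff l (i - j) (hyperderiv j a):] \<odot>\<^bsub>M\<^esub> m"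
    using im by (simp add: coord_sum coord_single F_single const_sum)
  also have "\<dots> = coord l (D_symbol i ([:a:] \<odot>\<^bsub>M\<^esub> m))"
    using im
    by (simp add: D_coeff_hyperderiv_sum coord_single smult_closed D_coeff_one zero_smult one_smult)
  finally show ?thesis
    unfolding r using im by (intro coord_diff_eq_zero) (auto intro!: F_sum F_single smult_closed)
qed

lemma coord_submodule:
  assumes "f \<in> N"
  shows "coord l f = \<zero>\<^bsub>M\<^esub>"
proof -
  have "N \<subseteq> {f \<in> carrier F. \<forall>l. coord l f = \<zero>\<^bsub>M\<^esub>}"
    unfolding prolongation_submodule_def
  proof (rule F.left_span_least)
    show "prolongation_relations k M \<subseteq> {f \<in> carrier F. \<forall>l. coord l f = \<zero>\<^bsub>M\<^esub>}"
      using relations_subset coord_relations by auto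
  qed (auto simp: F.smult_closed F_simps(2-4)[simplified] coord_add coord_smult smult_zero
      F.smult_closed[unfolded F_simps(4)] F_add_closed intro: F.M.zero_closed[unfolded F_simps(2)])
  with assms show ?thesis by auto
qed

sublocale N: left_submodule K_t F N
proof (intro left_submodule.intro left_submodule_axioms.intro F_left_module)
qed (use relations_subset in \<open>auto simp: prolongation_submodule_def
    intro: F.left_span_zero F.left_span_add F.left_span_smult subsetD[OF F.left_span_subset_carrier]\<close>)

lemma N_add: "\<lbrakk>f \<in> N; g \<in> N\<rbrakk> \<Longrightarrow> f + g \<in> N"
  using N.submodule_add[of f g] by (simp add: F_simps(3))

lemma N_zero: "0 \<in> N"
  using N.submodule_zero by (simp add: F_simps(2))

lemma N_minus: "f \<in> N \<Longrightarrow> - f \<in> N"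
  using N.N.a_inv_closed[of f] N.submodule_subset F_minus by auto

lemma N_sum: "(\<And>i. i \<in> A \<Longrightarrow> f i \<in> N) \<Longrightarrow> sum f A \<in> N"
  by (induction A rule: infinite_finite_induct) (auto intro: N_add N_zero)

lemma relation_in_N: "r \<in> prolongation_relations k M \<Longrightarrow> r \<in> N"
  unfolding prolongation_submodule_def by (rule F.left_span_base[OF relations_subset])

lemma N_relation_add:
  assumes "i \<le> k" "m \<in> carrier M" "m' \<in> carrier M"
  shows "D_symbol i m + D_symbol i m' - D_symbol i (m \<oplus>\<^bsub>M\<^esub> m') \<in> N"
proof -
  have "D_symbol i (m \<oplus>\<^bsub>M\<^esub> m') - (D_symbol i m + D_symbol i m') \<in> N"
    using assms by (intro relation_in_N) (auto simp: prolongation_relations_def)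
  from N_minus[OF this] show ?thesis by simp
qed

lemma N_relation_smult:
  assumes "i \<le> k" "m \<in> carrier M"
  shows "(\<Sum>j\<le>i. Poly_Mapping.single (i - j, m) (hyperderiv j a)) - D_symbol i ([:a:] \<odot>\<^bsub>M\<^esub> m) \<in> N"
proof -
  have "D_symbol i ([:a:] \<odot>\<^bsub>M\<^esub> m) - (\<Sum>j\<le>i. Poly_Mapping.single (i - j, m) (hyperderiv j a)) \<in> N"
    using assms by (intro relation_in_N) (auto simp: prolongation_relations_def)
  from N_minus[OF this] show ?thesis by simp
qed

text \<open>The other half of the binomial inversion: expanding all \<open>D\<^sub>l (c\<^sub>l m)\<close> with the Leibniz relation
  gives back \<open>a \<cdot> D\<^sub>i m\<close>.\<close>

lemma single_eq_D_coeff_sum: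
  "Poly_Mapping.single (i, m) a =
    (\<Sum>l\<le>i. \<Sum>j\<le>l. Poly_Mapping.single (l - j, m) (hyperderiv j (D_coeff l i a)))"
proof -
  have "(\<Sum>l\<le>i. \<Sum>j\<le>l. Poly_Mapping.single (l - j, m) (hyperderiv j (D_coeff l i a))) =
      (\<Sum>l\<in>{..i}. \<Sum>r | r \<in> {..i} \<and> r \<le> l. Poly_Mapping.single (r, m) (hyperderiv (l - r) (D_coeff l i a)))"
  proof (rule sum.cong[OF refl])
    fix l assume "l \<in> {..i}"
    then show "(\<Sum>j\<le>l. Poly_Mapping.single (l - j, m) (hyperderiv j (D_coeff l i a))) =
        (\<Sum>r | r \<in> {..i} \<and> r \<le> l. Poly_Mapping.single (r, m) (hyperderiv (l - r) (D_coeff l i a)))"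
      by (intro sum.reindex_bij_witness[of _ "\<lambda>r. l - r" "\<lambda>j. l - j"]) auto
  qed
  also have "\<dots> = (\<Sum>r\<in>{..i}. \<Sum>l | l \<in> {..i} \<and> r \<le> l. Poly_Mapping.single (r, m) (hyperderiv (l - r) (D_coeff l i a)))"
    by (rule sum.swap_restrict) auto
  also have "\<dots> = (\<Sum>r\<in>{..i}. Poly_Mapping.single (r, m) (if r = i then a else 0))"
  proof (rule sum.cong[OF refl])
    fix r assume "r \<in> {..i}"
    moreover have "{l. l \<in> {..i} \<and> r \<le> l} = {r..i}" by auto
    ultimately show "(\<Sum>l | l \<in> {..i} \<and> r \<le> l. Poly_Mapping.single (r, m) (hyperderiv (l - r) (D_coeff l i a))) =
        Poly_Mapping.single (r, m) (if r = i then a else 0)"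
      by (simp add: single_sum[symmetric] hyperderiv_D_coeff_sum)
  qed
  also have "\<dots> = (\<Sum>r\<in>{..i}. if r = i then Poly_Mapping.single (i, m) a else 0)"
    by (intro sum.cong) auto
  finally show ?thesis by simp
qed

text \<open>Every combination of symbols is congruent to the sum of the \<open>D\<^sub>l\<close> of its coordinates. On a single
  \<open>a \<cdot> D\<^sub>i m\<close> the difference is a sum of Leibniz relations, and the additivity relations take care of sums.\<close>

lemma coord_decomposition:
  assumes "f \<in> carrier F"
  shows "f - (\<Sum>l\<le>k. D_symbol l (coord l f)) \<in> N"
  using assms
proof (induction f rule: F_induct)
  case zero
  have "D_symbol l \<zero>\<^bsub>M\<^esub> \<in> N" if "l \<le> k" for l
    using N_relation_add[OF that M.M.zero_closed M.M.zero_closed] by simp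
  then have "- (\<Sum>l\<le>k. D_symbol l \<zero>\<^bsub>M\<^esub>) \<in> N" by (intro N_minus N_sum) auto
  then show ?case by simp
next
  case (add f g)
  let ?d = "\<lambda>l. D_symbol l (coord l f) + D_symbol l (coord l g) - D_symbol l (coord l (f + g))"
  have "(\<Sum>l\<le>k. ?d l) \<in> N"
    using add.hyps by (intro N_sum) (simp add: N_relation_add coord_add coord_closed)
  from N_add[OF N_add[OF add.IH] this] show ?case
    by (simp add: sum.distrib sum_subtractf algebra_simps)
next
  case (single i m a)
  let ?s = "\<lambda>l. \<Sum>j\<le>l. Poly_Mapping.single (l - j, m) (hyperderiv j (D_coeff l i a))"
  have "(\<Sum>l\<le>k. ?s l - D_symbol l ([:D_coeff l i a:] \<odot>\<^bsub>M\<^esub> m)) \<in> N"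
    using single by (intro N_sum N_relation_smult) auto
  moreover have "(\<Sum>l\<le>k. ?s l) = Poly_Mapping.single (i, m) a"
    unfolding single_eq_D_coeff_sum[of i m a] using single
    by (intro sum.mono_neutral_right) (auto simp: D_coeff_def)
  ultimately show ?case
    using single by (simp add: coord_single sum_subtractf)
qed

text \<open>The coordinates separate the points of the prolongation, so anything about the quotient
  can be tested on coordinates.\<close>

lemma in_N_iff: "f \<in> N \<longleftrightarrow> f \<in> carrier F \<and> (\<forall>l\<le>k. coord l f = \<zero>\<^bsub>M\<^esub>)"
proof
  assume "f \<in> N"
  then show "f \<in> carrier F \<and> (\<forall>l\<le>k. coord l f = \<zero>\<^bsub>M\<^esub>)"
    using N.submodule_subset coord_submodule by auto
next
  assume f: "f \<in> carrier F \<and> (\<forall>l\<le>k. coord l f = \<zero>\<^bsub>M\<^esub>)"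
  have "D_symbol l \<zero>\<^bsub>M\<^esub> \<in> N" if "l \<le> k" for l
    using N_relation_add[OF that M.M.zero_closed M.M.zero_closed] by simp
  then have "(\<Sum>l\<le>k. D_symbol l (coord l f)) \<in> N" using f by (intro N_sum) auto
  from N_add[OF coord_decomposition[OF conjunct1[OF f]] this] show "f \<in> N" by simp
qed

end

section \<open>The prolongation is a frame\<close>

context prolongation_setup
begin

abbreviation tau_F :: "((nat \<times> 'm) \<Rightarrow>\<^sub>0 'k poly) \<Rightarrow> ((nat \<times> 'm) \<Rightarrow>\<^sub>0 'k poly)" where
  "tau_F \<equiv> symbols_tau q M"

lemma symbols_tau_eq:
  assumes "finite A" "Poly_Mapping.keys f \<subseteq> A"
  shows "tau_F f = (\<Sum>(i, m)\<in>A. Poly_Mapping.single (i, skew_tau \<odot>\<^bsub>M\<^esub> m)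
    (twist q (Poly_Mapping.lookup f (i, m))))"
  unfolding symbols_tau_def
  using assms by (intro sum.mono_neutral_left) (auto simp: Poly_Mapping.in_keys_iff)

lemma symbols_tau_zero: "tau_F 0 = 0"
  by (simp add: symbols_tau_def)

lemma symbols_tau_single:
  "tau_F (Poly_Mapping.single (i, m) a) = Poly_Mapping.single (i, skew_tau \<odot>\<^bsub>M\<^esub> m) (twist q a)"
  by (subst symbols_tau_eq[of "{(i, m)}"]) auto

lemma symbols_tau_add: "tau_F (f + g) = tau_F f + tau_F g"
proof -
  let ?A = "Poly_Mapping.keys f \<union> Poly_Mapping.keys g"
  have eq: "tau_F h = (\<Sum>(i, m)\<in>?A. Poly_Mapping.single (i, skew_tau \<odot>\<^bsub>M\<^esub> m)
      (twist q (Poly_Mapping.lookup h (i, m))))" if "Poly_Mapping.keys h \<subseteq> ?A" for h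
    using that by (intro symbols_tau_eq) auto
  show ?thesis
    by (subst (1 2 3) eq) (auto simp: Poly_Mapping.keys_add Poly_Mapping.lookup_add twist_add
        Poly_Mapping.single_add sum.distrib case_prod_beta simp del: One_nat_def)
qed

lemma symbols_tau_closed: "f \<in> carrier F \<Longrightarrow> tau_F f \<in> carrier F"
proof (induction f rule: F_induct)
  case zero
  show ?case using F.M.zero_closed by (simp add: symbols_tau_zero F_simps(2))
qed (simp_all add: symbols_tau_single F_single smult_closed symbols_tau_add F_add_closed
    del: One_nat_def)

lemma F_smult_single:
  "Poly_Mapping.map ((*) a) (Poly_Mapping.single x b) = Poly_Mapping.single x (a * b :: 'k poly)"
  by (rule poly_mapping_eqI) (simp add: lookup_map_mult Poly_Mapping.lookup_single when_def)

lemma F_smult_add: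
  "Poly_Mapping.map ((*) a) (f + g) = Poly_Mapping.map ((*) a) f + Poly_Mapping.map ((*) (a :: 'k poly)) g"
  by (rule poly_mapping_eqI) (simp add: lookup_map_mult Poly_Mapping.lookup_add distrib_left)

lemma F_smult_zero: "Poly_Mapping.map ((*) (a :: 'k poly)) 0 = 0"
  by (rule poly_mapping_eqI) (simp add: lookup_map_mult)

lemma symbols_tau_smult:
  "f \<in> carrier F \<Longrightarrow> tau_F (Poly_Mapping.map ((*) a) f) = Poly_Mapping.map ((*) (twist q a)) (tau_F f)"
  by (induction f rule: F_induct)
    (simp_all add: F_smult_zero F_smult_single F_smult_add symbols_tau_zero symbols_tau_single
      symbols_tau_add twist_mult del: One_nat_def)

lemma coord_symbols_tau:
  "f \<in> carrier F \<Longrightarrow> coord l (tau_F f) = skew_tau \<odot>\<^bsub>M\<^esub> coord l f"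
  by (induction f rule: F_induct)
    (simp_all add: symbols_tau_zero smult_zero symbols_tau_single coord_single smult_closed
      twist_D_coeff tau_const symbols_tau_add coord_add symbols_tau_closed coord_closed smult_distrib
      del: One_nat_def)

text \<open>On coordinates \<open>symbols_tau\<close> is just \<open>\<tau>\<close>, so it preserves their common kernel and descends to the
  quotient.\<close>

lemma symbols_tau_N: "f \<in> N \<Longrightarrow> tau_F f \<in> N"
  by (simp add: in_N_iff symbols_tau_closed coord_symbols_tau smult_zero del: One_nat_def)

abbreviation Q :: "('k poly, ((nat \<times> 'm) \<Rightarrow>\<^sub>0 'k poly) set) module" where
  "Q \<equiv> prolongation_module k M"
abbreviation proj :: "((nat \<times> 'm) \<Rightarrow>\<^sub>0 'k poly) \<Rightarrow> ((nat \<times> 'm) \<Rightarrow>\<^sub>0 'k poly) set" where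
  "proj f \<equiv> N +>\<^bsub>F\<^esub> f"

lemma Q_left_module: "left_module K_t Q"
  unfolding prolongation_module_def by (rule N.quotient_left_module)

lemma Q_carrier: "carrier Q = proj ` carrier F"
  unfolding prolongation_module_def by (rule N.quotient_carrier)

lemma Q_add: "\<lbrakk>f \<in> carrier F; g \<in> carrier F\<rbrakk> \<Longrightarrow> proj f \<oplus>\<^bsub>Q\<^esub> proj g = proj (f + g)"
  unfolding prolongation_module_def by (simp add: N.quotient_add F_simps(3))

lemma Q_smult: "f \<in> carrier F \<Longrightarrow> a \<odot>\<^bsub>Q\<^esub> proj f = proj (Poly_Mapping.map ((*) a) f)"
  unfolding prolongation_module_def by (simp add: N.quotient_smult type_ring_simps F_simps(4))

lemma prolongation_tau_proj:
  assumes "f \<in> carrier F"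
  shows "prolongation_tau q k M (proj f) = proj (tau_F f)"
  unfolding prolongation_tau_def
  using assms by (intro N.coset_image_Union)
    (auto simp: symbols_tau_closed F_simps(3) symbols_tau_add symbols_tau_N)

lemma F_smult_closed: "f \<in> carrier F \<Longrightarrow> Poly_Mapping.map ((*) a) f \<in> carrier F"
  using F.smult_closed[of a f] by (simp add: type_ring_simps F_simps(4))

lemma semilinear_prolongation_tau: "semilinear q Q (prolongation_tau q k M)"
proof (intro semilinear.intro semilinear_axioms.intro Q_left_module skew_ring_axioms)
qed (auto simp: Q_carrier prolongation_tau_proj symbols_tau_closed Q_add Q_smult symbols_tau_add
    symbols_tau_smult F_smult_closed F_add_closed)

sublocale T: semilinear q field_type Q "prolongation_tau q k M"
  by (rule semilinear_prolongation_tau)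

abbreviation P :: "('k poly poly, ((nat \<times> 'm) \<Rightarrow>\<^sub>0 'k poly) set) module" where
  "P \<equiv> prolongation q k M"

lemma P_carrier: "carrier P = proj ` carrier F"
  by (simp add: prolongation_def T.skew_module_simps Q_carrier)

lemma P_add: "\<lbrakk>f \<in> carrier F; g \<in> carrier F\<rbrakk> \<Longrightarrow> proj f \<oplus>\<^bsub>P\<^esub> proj g = proj (f + g)"
  by (simp add: prolongation_def T.skew_module_simps Q_add)

lemma P_const: "f \<in> carrier F \<Longrightarrow> [:a:] \<odot>\<^bsub>P\<^esub> proj f = proj (Poly_Mapping.map ((*) a) f)"
  by (simp add: prolongation_def T.act_const Q_carrier Q_smult)

lemma P_tau: "f \<in> carrier F \<Longrightarrow> skew_tau \<odot>\<^bsub>P\<^esub> proj f = proj (tau_F f)"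
  by (simp add: prolongation_def T.act_tau Q_carrier prolongation_tau_proj del: One_nat_def)

lemma P_left_module: "left_module (skew_poly_ring q) P"
  unfolding prolongation_def by (rule T.skew_module_left_module)

lemma P_sum:
  assumes "f \<in> A \<rightarrow> carrier F"
  shows "proj (sum f A) = finsum P (\<lambda>i. proj (f i)) A"
proof -
  interpret P: left_module "skew_poly_ring q" P by (rule P_left_module)
  show ?thesis
    using finsum_additive_map[OF F.M.abelian_group_axioms P.M.abelian_group_axioms _ _ assms, of proj]
    by (simp add: P_carrier P_add F_simps(3) finsum_free_module_on(1)[OF assms])
qed

lemma proj_eqI: "\<lbrakk>f \<in> carrier F; g \<in> carrier F; f - g \<in> N\<rbrakk> \<Longrightarrow> proj f = proj g"
  by (rule N.coset_eqI) (simp_all add: F_diff)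

lemma coord_proj_cong:
  assumes "f \<in> carrier F" "g \<in> carrier F" "proj f = proj g"
  shows "coord l f = coord l g"
proof -
  have "f - g \<in> N" using N.coset_eqD[OF assms] assms by (simp add: F_diff)
  then have "coord l (f - g) = \<zero>\<^bsub>M\<^esub>" by (rule coord_submodule)
  then show ?thesis
    using coord_add[OF F_diff_closed[OF assms(1,2)] assms(2), of l] coord_closed[OF assms(2)] by simp
qed

definition D :: "nat \<Rightarrow> 'm \<Rightarrow> ((nat \<times> 'm) \<Rightarrow>\<^sub>0 'k poly) set" where
  "D i m = proj (D_symbol i m)"

text \<open>The coordinates of an arbitrary representative of the coset; they do not depend on its choice
  (\<open>coord_proj_cong\<close>).\<close>

definition \<psi> :: "nat \<Rightarrow> ((nat \<times> 'm) \<Rightarrow>\<^sub>0 'k poly) set \<Rightarrow> 'm" where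
  "\<psi> l C = coord l (SOME f. f \<in> carrier F \<and> proj f = C)"

lemma \<psi>_proj:
  assumes "f \<in> carrier F"
  shows "\<psi> l (proj f) = coord l f"
proof -
  have "(SOME g. g \<in> carrier F \<and> proj g = proj f) \<in> carrier F \<and>
      proj (SOME g. g \<in> carrier F \<and> proj g = proj f) = proj f"
    by (rule someI[of _ f]) (use assms in simp)
  then show ?thesis
    unfolding \<psi>_def using assms by (intro coord_proj_cong) auto
qed

lemma proj_decomposition:
  assumes "f \<in> carrier F"
  shows "proj f = finsum P (\<lambda>l. D l (coord l f)) {..k}"
proof -
  have D: "D_symbol l (coord l f) \<in> carrier F" if "l \<le> k" for l
    using that assms by (intro F_single coord_closed)
  have "proj f = proj (\<Sum>l\<le>k. D_symbol l (coord l f))"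
    using assms D by (intro proj_eqI F_sum coord_decomposition) auto
  then show ?thesis
    using D by (simp add: P_sum D_def)
qed

lemma D_frame: "prolongation_frame q M P k D \<psi>"
proof (intro prolongation_frame.intro prolongation_setup_axioms P_left_module
    prolongation_frame_axioms.intro conjI skew_ring_axioms M.left_module_axioms)
  fix i m assume im: "i \<le> k" "m \<in> carrier M"
  show "D i m \<in> carrier P"
    using im by (simp add: D_def P_carrier F_single)
  show "D i (skew_tau \<odot>\<^bsub>M\<^esub> m) = skew_tau \<odot>\<^bsub>P\<^esub> D i m"
    using im by (simp add: D_def P_tau F_single symbols_tau_single del: One_nat_def)
  show "\<psi> l (D i m) = (if l = i then m else \<zero>\<^bsub>M\<^esub>)" for l
    using im by (simp add: D_def \<psi>_proj F_single coord_single D_coeff_one one_smult zero_smult)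
  show "D i (m \<oplus>\<^bsub>M\<^esub> m') = D i m \<oplus>\<^bsub>P\<^esub> D i m'" if m': "m' \<in> carrier M" for m'
  proof -
    have "D i m \<oplus>\<^bsub>P\<^esub> D i m' = proj (D_symbol i m + D_symbol i m')"
      using im m' by (simp add: D_def P_add F_single)
    also have "\<dots> = D i (m \<oplus>\<^bsub>M\<^esub> m')"
      unfolding D_def using im m' by (intro proj_eqI N_relation_add F_add_closed F_single) auto
    finally show ?thesis ..
  qed
  show "[:a:] \<odot>\<^bsub>P\<^esub> D i m = finsum P (\<lambda>l. D l ([:D_coeff l i a:] \<odot>\<^bsub>M\<^esub> m)) {..k}" for a
    using im proj_decomposition[of "Poly_Mapping.single (i, m) a"]
    by (simp add: D_def P_const F_single F_smult_single coord_single)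
  show "D i ([:a:] \<odot>\<^bsub>M\<^esub> m) = finsum P (\<lambda>j. [:hyperderiv j a:] \<odot>\<^bsub>P\<^esub> D (i - j) m) {..i}" for a
  proof -
    let ?s = "\<lambda>j. Poly_Mapping.single (i - j, m) (hyperderiv j a)"
    have s: "?s j \<in> carrier F" for j using im by (intro F_single) auto
    have "D i ([:a:] \<odot>\<^bsub>M\<^esub> m) = proj (\<Sum>j\<le>i. ?s j)"
      unfolding D_def using im s
      by (intro proj_eqI[symmetric] N_relation_smult) (auto intro: F_sum F_single smult_closed)
    also have "\<dots> = finsum P (\<lambda>j. proj (?s j)) {..i}"
      using s by (intro P_sum) auto
    also have "(\<lambda>j. proj (?s j)) = (\<lambda>j. [:hyperderiv j a:] \<odot>\<^bsub>P\<^esub> D (i - j) m)"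
      using im by (auto simp: D_def P_const F_single F_smult_single)
    finally show ?thesis .
  qed
next
  fix x l assume "x \<in> carrier P"
  then obtain f where f: "f \<in> carrier F" "x = proj f" by (auto simp: P_carrier)
  then show "\<psi> l x \<in> carrier M" by (simp add: \<psi>_proj coord_closed)
  show "x = finsum P (\<lambda>l. D l (\<psi> l x)) {..k}"
    unfolding f(2) \<psi>_proj[OF f(1)] by (rule proj_decomposition[OF f(1)])
  show "\<psi> l (x \<oplus>\<^bsub>P\<^esub> y) = \<psi> l x \<oplus>\<^bsub>M\<^esub> \<psi> l y" if "y \<in> carrier P" for y
    using f that by (auto simp: P_carrier P_add \<psi>_proj F_add_closed coord_add)
qed

end

section \<open>Prolongations of t-motives\<close>

theorem t_motive_prolongation:
  assumes "0 < q" "t_motive q \<theta> M"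
  shows "t_motive q \<theta> (prolongation q k M)"
    and "abelian_t_motive q \<theta> M \<Longrightarrow> abelian_t_motive q \<theta> (prolongation q k M)"
proof -
  interpret M: left_module "skew_poly_ring q" M
    using assms(2) by (simp add: t_motive_def)
  interpret prolongation_setup q "TYPE('a)" M k
    by (intro prolongation_setup.intro skew_ring.intro assms(1) M.ring_axioms M.left_module_axioms)
  interpret prolongation_frame q "TYPE('a)" M "prolongation q k M" k D \<psi>
    by (rule D_frame)
  show "t_motive q \<theta> (prolongation q k M)"
    using assms(2) by (rule t_motive_frame)
  show "abelian_t_motive q \<theta> (prolongation q k M)" if "abelian_t_motive q \<theta> M"
    using that by (rule abelian_t_motive_frame)
qed

theorem theorem3p4:
  fixes F :: "'k::field set" and \<theta> :: 'k
    and M :: "('k poly poly, 'm) module" and k :: nat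
  assumes "finite F"
    and "subfield F (ring_of_type_algebra :: 'k ring)"
    and "ring.transcendental (ring_of_type_algebra :: 'k ring) F \<theta>"
    and "ring.finite_dimension (ring_of_type_algebra :: 'k ring)
           (generate_field ring_of_type_algebra (insert \<theta> F)) UNIV"
    and "t_motive (card F) \<theta> M"
  shows "t_motive (card F) \<theta> (prolongation (card F) k M) \<and>
    (abelian_t_motive (card F) \<theta> M \<longrightarrow>
       abelian_t_motive (card F) \<theta> (prolongation (card F) k M))"
proof -
  have "\<one>\<^bsub>ring_of_type_algebra :: 'k ring\<^esub> \<in> F"
    by (rule subringE(3)[OF subfieldE(1)[OF assms(2)]])
  then have "0 < card F"
    using assms(1) by (auto simp: card_gt_0_iff)
  then show ?thesis
    using assms(5) t_motive_prolongation by blast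
qed

end
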